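(* For each $n$ let $G=G_n$ be a connected simple undirected graph with vertex set $\{1,\dots,n\}$, and suppose that the graphs satisfy the geometry assumption with parameter $r\ge 1$. Let $\sigma>0$ be fixed, and for $f:\{1,\dots,n\}\to\mathbb{R}$ let $\mathbb{E}_f$ denote expectation under the model in which one observes $Y=(Y_1,\dots,Y_n)$ with $$Y_i=f(i)+\sigma\xi_i,\qquad i=1,\dots,n,$$ where $\xi_1,\dots,\xi_n$ are independent standard Gaussian random variables. Then for all $\beta,Q>0$, $$\inf_{\hat f}\ \sup_{f\in H^\beta(Q)}\mathbb{E}_f\|\hat f-f\|_n^2\asymp n^{-2\beta/(2\beta+r)}\qquad (n\to\infty),$$ where the infimum is over all estimators $\hat f=\hat f(Y_1,\dots,Y_n)$ (measurable functions of the data with values in the functions on $\{1,\dots,n\}$).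
   Context: Notation. For sequences of positive numbers, $a_n\asymp b_n$ means $0<\liminf a_n/b_n\le\limsup a_n/b_n<\infty$. A function on the graph is a function $f:\{1,\dots,n\}\to\mathbb{R}$. The inner product is $\langle f,g\rangle_n=\frac1n\sum_{i=1}^n f(i)g(i)$ with norm $\|f\|_n^2=\langle f,f\rangle_n$. Graph Laplacian. $L=D-A$, where $A$ is the adjacency matrix and $D$ the diagonal matrix of vertex degrees. Its eigenvalues (which depend on $n$), counted with multiplicity, are ordered as $0=\lambda_0<\lambda_1\le\lambda_2\le\dots\le\lambda_{n-1}$. Geometry assumption with parameter $r\ge1$ (for the sequence of graphs $G_n$): there exist $i_0\in\mathbb{N}$, $\kappa\in(0,1]$ and $C_1,C_2>0$ (all independent of $n$) such that for all $n$ large enough, $C_1(i/n)^{2/r}\le\lambda_i\le C_2(i/n)^{2/r}$ for all integers $i$ with $i_0\le i\le\kappa n$ (and $i\le n-1$). The parameter $r$ is real, not necessarily an integer. Sobolev-type ball. For $\beta,Q>0$ (independent of $n$), $H^\beta(Q)=\{f:\{1,\dots,n\}\to\mathbb{R}:\ \langle f,(I+(n^{2/r}L)^\beta)f\rangle_n\le Q^2\}$, where the power of the nonnegative definite matrix $n^{2/r}L$ is defined through its spectral decomposition (with $0^\beta=0$). *)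

theory Defs
  imports
    "HOL-Probability.Probability"
    "Graph_Theory.Graph_Theory"
    "Jordan_Normal_Form.Char_Poly"
begin

no_notation Finite_Cartesian_Product.vec_nth (infixl \<open>$\<close> 90)

text \<open>
  A function on the graph is an element of \<open>{1..n} \<rightarrow>\<^sub>E UNIV\<close>, which is also the space of
  \<open>PiM {1..n} (\<lambda>_. borel)\<close>. Matrices are indexed from 0, so vertex \<open>i\<close> corresponds to row and
  column \<open>i - 1\<close>.
\<close>

definition inner_n :: "nat \<Rightarrow> (nat \<Rightarrow> real) \<Rightarrow> (nat \<Rightarrow> real) \<Rightarrow> real" where
  "inner_n n f g = (\<Sum>i=1..n. f i * g i) / real n"

definition norm_n :: "nat \<Rightarrow> (nat \<Rightarrow> real) \<Rightarrow> real" where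
  "norm_n n f = sqrt (inner_n n f f)"

definition apply_mat :: "nat \<Rightarrow> real mat \<Rightarrow> (nat \<Rightarrow> real) \<Rightarrow> (nat \<Rightarrow> real)" where
  "apply_mat n M f = (\<lambda>i\<in>{1..n}. (M *\<^sub>v Matrix.vec n (\<lambda>k. f (k + 1))) $ (i - 1))"

definition adjacency_mat :: "nat \<Rightarrow> nat pair_pre_digraph \<Rightarrow> real mat" where
  "adjacency_mat n G =
     Matrix.mat n n (\<lambda>(i, j). if (i + 1, j + 1) \<in> parcs G then 1 else 0)"

text \<open>In a symmetric digraph the number of outgoing arcs is the degree of the undirected graph.\<close>

definition degree_mat :: "nat \<Rightarrow> nat pair_pre_digraph \<Rightarrow> real mat" where
  "degree_mat n G = mat_diag n (\<lambda>i. real (out_degree (with_proj G) (i + 1)))"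

definition laplacian :: "nat \<Rightarrow> nat pair_pre_digraph \<Rightarrow> real mat" where
  "laplacian n G = degree_mat n G - adjacency_mat n G"

text \<open>
  \<open>lap_eigenvalue n G i\<close> is the entry at position \<open>i\<close>, counted from 0, of the increasing list of
  the roots of the characteristic polynomial with multiplicity. It is unspecified for \<open>i \<ge> n\<close>.
\<close>

definition lap_eigenvalue :: "nat \<Rightarrow> nat pair_pre_digraph \<Rightarrow> nat \<Rightarrow> real" where
  "lap_eigenvalue n G i = sorted_list_of_multiset (proots (char_poly (laplacian n G))) ! i"

definition geometry_assumption :: "real \<Rightarrow> (nat \<Rightarrow> nat pair_pre_digraph) \<Rightarrow> bool" where
  "geometry_assumption r G \<longleftrightarrow>
     (\<exists>(i0::nat) (\<kappa>::real) (C1::real) (C2::real).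
        0 < \<kappa> \<and> \<kappa> \<le> 1 \<and> 0 < C1 \<and> 0 < C2 \<and>
        (\<forall>\<^sub>F n in sequentially. \<forall>i::nat.
           i0 \<le> i \<and> real i \<le> \<kappa> * real n \<and> i < n \<longrightarrow>
             C1 * (real i / real n) powr (2 / r) \<le> lap_eigenvalue n (G n) i \<and>
             lap_eigenvalue n (G n) i \<le> C2 * (real i / real n) powr (2 / r)))"

text \<open>
  Power of a symmetric nonnegative definite matrix \<open>M = U diag(d) U\<^sup>T\<close> with \<open>U\<close> orthogonal. The
  result does not depend on the chosen decomposition. Note that \<open>0 powr b = 0\<close> for every \<open>b\<close>.
\<close>

definition mat_powr :: "real mat \<Rightarrow> real \<Rightarrow> real mat" where
  "mat_powr M b = (let n = dim_row M in
     SOME B. \<exists>U d. U \<in> carrier_mat n n \<and> transpose_mat U * U = 1\<^sub>m n \<and>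
       M = U * mat_diag n d * transpose_mat U \<and>
       B = U * mat_diag n (\<lambda>i. d i powr b) * transpose_mat U)"

definition sobolev_ball ::
    "nat \<Rightarrow> nat pair_pre_digraph \<Rightarrow> real \<Rightarrow> real \<Rightarrow> real \<Rightarrow> (nat \<Rightarrow> real) set" where
  "sobolev_ball n G r \<beta> Q =
     {f \<in> {1..n} \<rightarrow>\<^sub>E UNIV.
        inner_n n f
          (apply_mat n
            (1\<^sub>m n + mat_powr ((real n powr (2 / r)) \<cdot>\<^sub>m laplacian n G) \<beta>) f) \<le> Q\<^sup>2}"

definition noise_measure :: "nat \<Rightarrow> (nat \<Rightarrow> real) measure" where
  "noise_measure n = PiM {1..n} (\<lambda>_. density lborel std_normal_density)"

definition data_law :: "nat \<Rightarrow> real \<Rightarrow> (nat \<Rightarrow> real) \<Rightarrow> (nat \<Rightarrow> real) measure" where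
  "data_law n \<sigma> f =
     distr (noise_measure n) (PiM {1..n} (\<lambda>_. borel)) (\<lambda>\<xi>. \<lambda>i\<in>{1..n}. f i + \<sigma> * \<xi> i)"

definition estimators :: "nat \<Rightarrow> ((nat \<Rightarrow> real) \<Rightarrow> (nat \<Rightarrow> real)) set" where
  "estimators n = measurable (PiM {1..n} (\<lambda>_. borel)) (PiM {1..n} (\<lambda>_. borel))"

text \<open>The risk is a nonnegative integral, since a general estimator may have infinite risk.\<close>

definition risk ::
    "nat \<Rightarrow> real \<Rightarrow> ((nat \<Rightarrow> real) \<Rightarrow> (nat \<Rightarrow> real)) \<Rightarrow> (nat \<Rightarrow> real) \<Rightarrow> ennreal" where
  "risk n \<sigma> fhat f =
     (\<integral>\<^sup>+ y. ennreal ((norm_n n (\<lambda>i. fhat y i - f i))\<^sup>2) \<partial>(data_law n \<sigma> f))"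

definition minimax_risk :: "nat \<Rightarrow> real \<Rightarrow> (nat \<Rightarrow> real) set \<Rightarrow> ennreal" where
  "minimax_risk n \<sigma> F = (INF fhat\<in>estimators n. SUP f\<in>F. risk n \<sigma> fhat f)"

definition asymp_order :: "(nat \<Rightarrow> ennreal) \<Rightarrow> (nat \<Rightarrow> ennreal) \<Rightarrow> bool" where
  "asymp_order a b \<longleftrightarrow>
     0 < liminf (\<lambda>n. a n / b n) \<and>
     liminf (\<lambda>n. a n / b n) \<le> limsup (\<lambda>n. a n / b n) \<and>
     limsup (\<lambda>n. a n / b n) < \<infinity>"

end

theory Submission
  imports Defs "HOL-Real_Asymp.Real_Asymp"
begin

text \<open>
  In an orthonormal eigenbasis of the Laplacian the ball becomes an ellipsoid whose \<open>j\<close>-th weight is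
  of order \<open>j powr (2 * \<beta> / r)\<close>, and the noise stays white. Cut at \<open>m\<close> of order
  \<open>n powr (r / (2 * \<beta> + r))\<close>, where variance and squared bias balance. Projecting the data onto the
  first \<open>m\<close> eigenvectors costs \<open>\<sigma>\<^sup>2 m / n\<close> in variance and at most \<open>Q\<^sup>2\<close> divided by the \<open>m\<close>-th
  weight in squared bias. Conversely, a hypercube with coordinates \<open>\<plusminus>a\<close>, for a constant \<open>a\<close>, in about \<open>m\<close> of these
  directions fits into the ellipsoid. Averaging over its vertices, each coordinate sign is a two-point
  testing problem at distance of the order of the noise level, so each coordinate costs a constant
  multiple of \<open>a\<^sup>2 / n\<close>.
\<close>

section \<open>Diagonalization of symmetric matrices\<close>

text \<open>Coefficients are taken with respect to \<open>dotp\<close>, the inner product without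
  the factor \<open>1 / n\<close>. An orthonormal coefficient of the data then has noise variance
  \<open>\<sigma>\<^sup>2\<close> for every n, so the cube amplitude need not shrink with n, and
  \<open>1 / n\<close> enters only through the loss. A cube vertex has energy of order
  \<open>m powr (1 + 2 * \<beta> / r)\<close>, to be compared with \<open>Q\<^sup>2 * n\<close>.
  This is the same balance as between variance and squared bias, so one cutoff serves both bounds.
  Two obstacles shape the rest. The matrix power is a choice among spectral decompositions, so the
  proof works in the eigenbasis behind the chosen value and recovers the ordered eigenvalues from
  that basis by similarity. The geometry assumption controls only a window of indices: the upper
  bound evaluates it at the single index m and extends it by monotonicity, while the lower bound
  uses indices between \<open>i0\<close> and m, losing a bounded number of directions. Estimators
  may have infinite risk, so the lower bound is carried out with nonnegative integrals, and both
  points of each test are referred to their midpoint by an explicit density.\<close>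

lemma continuous_on_double_coordinate:
  "continuous_on S (\<lambda>u :: 'a \<Rightarrow> 'b \<Rightarrow> 'c :: topological_space. u i k)"
  by (rule continuous_on_product_then_coordinatewise,
      rule continuous_on_subset[OF continuous_on_product_coordinates]) simp

text \<open>Tychonoff applied twice, once for each argument of the doubly indexed family.\<close>

lemma compact_double_PiE:
  fixes S :: "'a \<Rightarrow> 'b \<Rightarrow> 'c :: topological_space set"
  assumes "\<And>i k. compact (S i k)"
  shows "compact {u. \<forall>i k. u i k \<in> S i k}"
proof -
  have inner: "compact (Pi\<^sub>E UNIV (S i))" for i
  proof -
    have "compactin (product_topology (\<lambda>_. euclidean) UNIV) (Pi\<^sub>E UNIV (S i))"
      using assms by (auto simp: compactin_PiE)
    then show ?thesis by (simp add: euclidean_product_topology)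
  qed
  have "compactin (product_topology (\<lambda>_. euclidean) UNIV) (Pi\<^sub>E UNIV (\<lambda>i. Pi\<^sub>E UNIV (S i)))"
    using inner by (auto simp: compactin_PiE)
  moreover have "Pi\<^sub>E UNIV (\<lambda>i. Pi\<^sub>E UNIV (S i)) = {u. \<forall>i k. u i k \<in> S i k}"
    by (auto simp: PiE_def Pi_def)
  ultimately show ?thesis by (simp add: euclidean_product_topology)
qed

text \<open>A rotation keeps the trace A + D, so the sum of squares grows with the difference of the
  diagonal entries. Half the angle of the vector (A - D, 2 b) turns this difference into the length
  R of that vector, and the sum of squares gains \<open>2 * b\<^sup>2\<close>.\<close>

lemma ex_rotation_angle:
  fixes A D b :: real
  assumes "b \<noteq> 0"
  obtains c s where "c\<^sup>2 + s\<^sup>2 = 1"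
    "A\<^sup>2 + D\<^sup>2 < (c\<^sup>2 * A + 2 * c * s * b + s\<^sup>2 * D)\<^sup>2 + (s\<^sup>2 * A - 2 * c * s * b + c\<^sup>2 * D)\<^sup>2"
proof -
  define R where "R = sqrt ((A - D)\<^sup>2 + 4 * b\<^sup>2)"
  have R2: "R\<^sup>2 = (A - D)\<^sup>2 + 4 * b\<^sup>2" and R0: "R > 0"
    using assms by (simp_all add: R_def add_nonneg_pos)
  have "((A - D) / R)\<^sup>2 + (2 * b / R)\<^sup>2 = 1"
    unfolding power_divide add_divide_distrib[symmetric] power_mult_distrib R2 using R0
    by (auto simp: R_def)
  then obtain t where t: "(A - D) / R = cos t" "2 * b / R = sin t"
    by (rule sincos_total_2pi) auto
  define c where "c = cos (t / 2)"
  define s where "s = sin (t / 2)"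
  have cs: "c\<^sup>2 + s\<^sup>2 = 1" by (simp add: c_def s_def)
  have c2: "c\<^sup>2 - s\<^sup>2 = (A - D) / R"
    using cos_double[of "t / 2"] t by (simp add: c_def s_def)
  have s2: "2 * c * s = 2 * b / R"
    using sin_double[of "t / 2"] t by (simp add: c_def s_def mult_ac)
  define a' where "a' = c\<^sup>2 * A + 2 * c * s * b + s\<^sup>2 * D"
  define d' where "d' = s\<^sup>2 * A - 2 * c * s * b + c\<^sup>2 * D"
  have sum: "a' + d' = A + D"
  proof -
    have "a' + d' = (c\<^sup>2 + s\<^sup>2) * (A + D)" by (simp add: a'_def d'_def algebra_simps)
    then show ?thesis by (simp add: cs)
  qed
  have "a' - d' = (c\<^sup>2 - s\<^sup>2) * (A - D) + 2 * (2 * c * s) * b"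
    by (simp add: a'_def d'_def algebra_simps)
  also have "\<dots> = ((A - D)\<^sup>2 + 4 * b\<^sup>2) / R"
    unfolding c2 s2 by (simp add: power2_eq_square add_divide_distrib)
  also have "\<dots> = R" unfolding R2[symmetric] using R0 by (simp add: power2_eq_square)
  finally have diff: "a' - d' = R" .
  have "2 * (a'\<^sup>2 + d'\<^sup>2) = (a' + d')\<^sup>2 + (a' - d')\<^sup>2"
    by (simp add: power2_eq_square algebra_simps)
  also have "\<dots> = 2 * (A\<^sup>2 + D\<^sup>2) + 4 * b\<^sup>2"
    unfolding sum diff R2 by (simp add: power2_eq_square algebra_simps)
  finally have "2 * (a'\<^sup>2 + d'\<^sup>2) = 2 * (A\<^sup>2 + D\<^sup>2) + 4 * b\<^sup>2" .
  moreover have "b\<^sup>2 > 0" using assms by simp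
  ultimately have "A\<^sup>2 + D\<^sup>2 < a'\<^sup>2 + d'\<^sup>2" by argo
  then show ?thesis using that cs by (auto simp: a'_def d'_def)
qed

text \<open>
  Jacobi's argument: take an orthonormal system maximizing the sum of the squared diagonal entries.
  A nonzero off-diagonal entry could be removed by a rotation in the plane of the two vectors
  concerned, which would increase that sum.
\<close>

lemma ex_orthonormal_diagonalization:
  fixes a :: "nat \<Rightarrow> nat \<Rightarrow> real"
  assumes sym: "\<And>k l. k < n \<Longrightarrow> l < n \<Longrightarrow> a k l = a l k"
  obtains u :: "nat \<Rightarrow> nat \<Rightarrow> real" where
    "\<And>i j. i < n \<Longrightarrow> j < n \<Longrightarrow> (\<Sum>k<n. u i k * u j k) = (if i = j then 1 else 0)"
    "\<And>i j. i < n \<Longrightarrow> j < n \<Longrightarrow> i \<noteq> j \<Longrightarrow> (\<Sum>k<n. \<Sum>l<n. u i k * a k l * u j l) = 0"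
proof -
  define dot where "dot x y = (\<Sum>k<n. x k * y k)" for x y :: "nat \<Rightarrow> real"
  define bil where "bil x y = (\<Sum>k<n. \<Sum>l<n. x k * a k l * y l)" for x y
  have dot_sym: "dot x y = dot y x" for x y by (simp add: dot_def mult.commute)
  have dot_lin: "dot (\<lambda>k. \<alpha> * x k + \<gamma> * y k) z = \<alpha> * dot x z + \<gamma> * dot y z" for \<alpha> \<gamma> x y z
    by (simp add: dot_def sum_distrib_left sum.distrib algebra_simps)
  have bil_sym: "bil x y = bil y x" for x y
    unfolding bil_def by (subst sum.swap) (auto intro!: sum.cong simp: sym)
  have bil_lin: "bil (\<lambda>k. \<alpha> * x k + \<gamma> * y k) z = \<alpha> * bil x z + \<gamma> * bil y z" for \<alpha> \<gamma> x y z
    by (simp add: bil_def sum_distrib_left sum.distrib algebra_simps)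
  have dot_lin2: "dot z (\<lambda>k. \<alpha> * x k + \<gamma> * y k) = \<alpha> * dot z x + \<gamma> * dot z y" for \<alpha> \<gamma> x y z
    using dot_lin dot_sym by metis
  have bil_lin2: "bil z (\<lambda>k. \<alpha> * x k + \<gamma> * y k) = \<alpha> * bil z x + \<gamma> * bil z y" for \<alpha> \<gamma> x y z
    using bil_lin bil_sym by metis
  define F where "F u = (\<Sum>i<n. (bil (u i) (u i))\<^sup>2)" for u
  \<comment> \<open>The variables are functions on all of nat x nat. Fixing the entries outside the
    n x n block at 0 makes the box compact; inside the block, the bound 1 is automatic for unit
    vectors.\<close>
  define B where "B = {u :: nat \<Rightarrow> nat \<Rightarrow> real.
    \<forall>i k. u i k \<in> (if i < n \<and> k < n then {-1..1} else {0})}"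
  define K where "K = B \<inter> {u. \<forall>i<n. \<forall>j<n. dot (u i) (u j) = (if i = j then 1 else 0)}"
  note [continuous_intros] = continuous_on_double_coordinate
  have "compact B" unfolding B_def by (rule compact_double_PiE) auto
  moreover have "closed {u. \<forall>i<n. \<forall>j<n. dot (u i) (u j) = (if i = j then 1 else 0)}"
    unfolding dot_def
    by (intro closed_Collect_all closed_Collect_imp open_Collect_const closed_Collect_eq
        continuous_intros)
  ultimately have "compact K" unfolding K_def by (rule compact_Int_closed)
  moreover have "(\<lambda>i k. if i = k \<and> i < n then 1 else 0) \<in> K"
    by (auto simp: K_def B_def dot_def if_distrib[of "\<lambda>x. x * _"] cong: if_cong)
  then have "K \<noteq> {}" by blast
  moreover have "continuous_on K F"
    unfolding F_def bil_def by (intro continuous_intros)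
  ultimately obtain u where u: "u \<in> K" and umax: "\<forall>v\<in>K. F v \<le> F u"
    using continuous_attains_sup[of K F] by auto
  have uo: "dot (u i) (u j) = (if i = j then 1 else 0)" if "i < n" "j < n" for i j
    using u that by (auto simp: K_def)
  have ub: "bil (u p) (u q) = 0" if pq: "p < n" "q < n" "p \<noteq> q" for p q
  proof (rule ccontr)
    assume "bil (u p) (u q) \<noteq> 0"
    then obtain c s where cs: "c\<^sup>2 + s\<^sup>2 = 1" and less:
      "(bil (u p) (u p))\<^sup>2 + (bil (u q) (u q))\<^sup>2
       < (c\<^sup>2 * bil (u p) (u p) + 2 * c * s * bil (u p) (u q) + s\<^sup>2 * bil (u q) (u q))\<^sup>2
         + (s\<^sup>2 * bil (u p) (u p) - 2 * c * s * bil (u p) (u q) + c\<^sup>2 * bil (u q) (u q))\<^sup>2"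
      by (rule ex_rotation_angle)
    define x where "x k = c * u p k + s * u q k" for k
    define y where "y k = (-s) * u p k + c * u q k" for k
    define v where "v = u(p := x, q := y)"
    have v: "v p = x" "v q = y" "\<And>i. i \<noteq> p \<Longrightarrow> i \<noteq> q \<Longrightarrow> v i = u i"
      using pq by (auto simp: v_def)
    have xx: "dot x x = 1" and yy: "dot y y = 1" and xy: "dot x y = 0"
      using pq cs uo unfolding x_def y_def dot_lin dot_lin2
      by (simp_all add: power2_eq_square algebra_simps)
    have xo: "dot x (u i) = 0" "dot y (u i) = 0" "dot (u i) x = 0" "dot (u i) y = 0"
      if "i < n" "i \<noteq> p" "i \<noteq> q" for i
      using pq uo that unfolding x_def y_def dot_lin dot_lin2 by simp_all
    have yx: "dot y x = 0" using xy by (simp add: dot_sym)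
    have vo: "dot (v i) (v j) = (if i = j then 1 else 0)" if "i < n" "j < n" for i j
      using that pq(3)
      by (cases "i = p"; cases "i = q"; cases "j = p"; cases "j = q")
        (simp_all add: v xx yy xy yx xo uo)
    have "v i k \<in> (if i < n \<and> k < n then {-1..1} else {0})" for i k
    proof (cases "i < n \<and> k < n")
      case True
      have "(v i k)\<^sup>2 \<le> dot (v i) (v i)"
        unfolding dot_def power2_eq_square
        by (rule member_le_sum) (use True in auto)
      then have "\<bar>v i k\<bar> \<le> 1" using vo True by (simp add: abs_square_le_1)
      then show ?thesis using True by auto
    next
      case False
      have "u i k = 0" if "\<not> (i < n \<and> k < n)" for i k
        using u that by (auto simp: K_def B_def split: if_splits)
      then have "v i k = 0" using False pq by (auto simp: v_def x_def y_def)
      then show ?thesis using False by auto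
    qed
    then have "v \<in> K" using vo by (auto simp: K_def B_def)
    have "bil x x = c\<^sup>2 * bil (u p) (u p) + 2 * c * s * bil (u p) (u q) + s\<^sup>2 * bil (u q) (u q)"
      "bil y y = s\<^sup>2 * bil (u p) (u p) - 2 * c * s * bil (u p) (u q) + c\<^sup>2 * bil (u q) (u q)"
      unfolding x_def y_def bil_lin bil_lin2 bil_sym[of "u q" "u p"]
      by (simp_all add: power2_eq_square algebra_simps)
    then have less': "(bil (u p) (u p))\<^sup>2 + (bil (u q) (u q))\<^sup>2 < (bil x x)\<^sup>2 + (bil y y)\<^sup>2"
      using less by simp
    have split: "F w = (bil (w p) (w p))\<^sup>2 + ((bil (w q) (w q))\<^sup>2 +
        (\<Sum>i\<in>{..<n} - {p} - {q}. (bil (w i) (w i))\<^sup>2))" for w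
      unfolding F_def using pq by (simp add: sum.remove[of _ p] sum.remove[of _ q])
    have rest: "(\<Sum>i\<in>{..<n} - {p} - {q}. (bil (v i) (v i))\<^sup>2) =
        (\<Sum>i\<in>{..<n} - {p} - {q}. (bil (u i) (u i))\<^sup>2)"
      by (intro sum.cong) (auto simp: v(3))
    have "F u < F v" unfolding split rest v(1,2) using less' by simp
    with umax \<open>v \<in> K\<close> show False by (simp add: not_le[symmetric])
  qed
  show ?thesis
  proof (rule that)
    fix i j assume ij: "i < n" "j < n"
    show "(\<Sum>k<n. u i k * u j k) = (if i = j then 1 else 0)"
      using uo[OF ij] unfolding dot_def .
    assume "i \<noteq> j"
    then show "(\<Sum>k<n. \<Sum>l<n. u i k * a k l * u j l) = 0"
      using ub[OF ij] unfolding bil_def by blast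
  qed
qed

lemma symmetric_mat_diagonalization:
  fixes A :: "real mat"
  assumes A: "A \<in> carrier_mat n n" and sym: "\<And>k l. k < n \<Longrightarrow> l < n \<Longrightarrow> A $$ (k, l) = A $$ (l, k)"
  obtains U d where "U \<in> carrier_mat n n" "transpose_mat U * U = 1\<^sub>m n"
    "A = U * mat_diag n d * transpose_mat U"
proof -
  obtain u where uo: "\<And>i j. i < n \<Longrightarrow> j < n \<Longrightarrow> (\<Sum>k<n. u i k * u j k) = (if i = j then 1 else 0)"
    and ud: "\<And>i j. i < n \<Longrightarrow> j < n \<Longrightarrow> i \<noteq> j \<Longrightarrow>
      (\<Sum>k<n. \<Sum>l<n. u i k * (A $$ (k, l)) * u j l) = 0"
    using ex_orthonormal_diagonalization[of n "\<lambda>k l. A $$ (k, l)"] sym by blast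
  define U where "U = Matrix.mat n n (\<lambda>(k, i). u i k)"
  define d where "d i = (\<Sum>k<n. \<Sum>l<n. u i k * (A $$ (k, l)) * u i l)" for i
  have U: "U \<in> carrier_mat n n" by (simp add: U_def)
  have UU: "transpose_mat U * U = 1\<^sub>m n"
    by (rule eq_matI)
      (auto simp: U_def scalar_prod_def uo lessThan_atLeast0[symmetric])
  then have UU': "U * transpose_mat U = 1\<^sub>m n"
    using U by (meson mat_mult_left_right_inverse transpose_carrier_mat)
  have D: "transpose_mat U * A * U = mat_diag n d"
  proof (rule eq_matI)
    fix i j assume "i < dim_row (mat_diag n d)" "j < dim_col (mat_diag n d)"
    then have ij: "i < n" "j < n" by (simp_all add: mat_diag_def)
    have "(transpose_mat U * A * U) $$ (i, j) = (\<Sum>l<n. (\<Sum>k<n. u i k * A $$ (k, l)) * u j l)"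
      using ij A by (auto simp: U_def scalar_prod_def lessThan_atLeast0[symmetric])
    also have "\<dots> = (\<Sum>k<n. \<Sum>l<n. u i k * A $$ (k, l) * u j l)"
      by (simp add: sum_distrib_right) (rule sum.swap)
    finally show "(transpose_mat U * A * U) $$ (i, j) = mat_diag n d $$ (i, j)"
      using ij ud by (auto simp: mat_diag_def d_def)
  qed (use U A in \<open>auto simp: mat_diag_def\<close>)
  have "U * mat_diag n d * transpose_mat U = U * (transpose_mat U * A * U) * transpose_mat U"
    by (simp add: D)
  also have "\<dots> = (U * transpose_mat U) * A * (U * transpose_mat U)"
    using U A by (simp add: assoc_mult_mat[of _ n n _ n _ n])
  also have "\<dots> = A" using A by (simp add: UU')
  finally show ?thesis using that[OF U UU, of d] by simp
qed

section \<open>Sobolev balls in the eigenbasis\<close>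

text \<open>Unnormalized on purpose: for an orthonormal system, the coefficients of the noise then
  have variance exactly 1.\<close>

definition dotp :: "nat \<Rightarrow> (nat \<Rightarrow> real) \<Rightarrow> (nat \<Rightarrow> real) \<Rightarrow> real" where
  "dotp n f g = (\<Sum>i=1..n. f i * g i)"

definition orthonormal :: "nat \<Rightarrow> (nat \<Rightarrow> nat \<Rightarrow> real) \<Rightarrow> bool" where
  "orthonormal n u \<longleftrightarrow> (\<forall>j<n. \<forall>k<n. dotp n (u j) (u k) = (if j = k then 1 else 0))"

lemma dotp_lessThan: "dotp n f g = (\<Sum>k<n. f (Suc k) * g (Suc k))"
  by (simp add: dotp_def sum.atLeast1_atMost_eq)

lemma inner_n_dotp: "inner_n n f g = dotp n f g / real n"
  by (simp add: inner_n_def dotp_def)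

text \<open>An orthonormal system of n vectors in dimension n is complete: a left inverse of a
  square matrix is also a right inverse, which turns column orthonormality into row
  orthonormality.\<close>

lemma parseval:
  assumes "orthonormal n u"
  shows "dotp n f f = (\<Sum>j<n. (dotp n (u j) f)\<^sup>2)"
proof -
  define U where "U = Matrix.mat n n (\<lambda>(k, j). u j (Suc k))"
  have U: "U \<in> carrier_mat n n" by (simp add: U_def)
  have "transpose_mat U * U = 1\<^sub>m n"
    using assms
    by (intro eq_matI)
      (auto simp: U_def scalar_prod_def orthonormal_def dotp_lessThan lessThan_atLeast0[symmetric])
  then have UU: "U * transpose_mat U = 1\<^sub>m n"
    using U by (meson mat_mult_left_right_inverse transpose_carrier_mat)
  have complete: "(\<Sum>j<n. u j (Suc k) * u j (Suc l)) = (if k = l then 1 else 0)"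
    if "k < n" "l < n" for k l
  proof -
    have "(\<Sum>j<n. u j (Suc k) * u j (Suc l)) = (U * transpose_mat U) $$ (k, l)"
      using that by (simp add: U_def scalar_prod_def lessThan_atLeast0)
    then show ?thesis using that by (simp add: UU)
  qed
  have "(\<Sum>j<n. (dotp n (u j) f)\<^sup>2) =
      (\<Sum>j<n. \<Sum>k<n. \<Sum>l<n. f (Suc k) * f (Suc l) * (u j (Suc k) * u j (Suc l)))"
    by (simp add: dotp_lessThan power2_eq_square sum_product mult_ac)
  also have "\<dots> = (\<Sum>k<n. \<Sum>l<n. f (Suc k) * f (Suc l) * (\<Sum>j<n. u j (Suc k) * u j (Suc l)))"
    unfolding sum_distrib_left by (subst sum.swap, subst (2) sum.swap) rule
  also have "\<dots> = (\<Sum>k<n. \<Sum>l<n. f (Suc k) * f (Suc l) * (if k = l then 1 else 0))"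
    by (intro sum.cong refl) (simp add: complete)
  also have "\<dots> = dotp n f f"
    by (simp add: dotp_lessThan if_distrib[of "\<lambda>x. _ * x"] cong: if_cong)
  finally show ?thesis by simp
qed

lemma smult_diagonalization:
  fixes c :: real
  assumes "U \<in> carrier_mat n n"
  shows "c \<cdot>\<^sub>m (U * mat_diag n d * transpose_mat U) =
    U * mat_diag n (\<lambda>i. c * d i) * transpose_mat U"
proof -
  have "mat_diag n (\<lambda>i. c * d i) = c \<cdot>\<^sub>m mat_diag n d"
    by (auto simp: mat_diag_def)
  then show ?thesis using assms
    by (simp add: mult_smult_distrib[of _ n n _ n]
        mult_smult_assoc_mat[of _ n n _ n])
qed

lemma proots_prod_list_linear: "proots (\<Prod>a\<leftarrow>xs. [:- a, 1::real:]) = mset xs"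
proof (induction xs)
  case (Cons a xs)
  have "(\<Prod>a\<leftarrow>xs. [:- a, 1::real:]) \<noteq> 0" by (auto simp: prod_list_zero_iff)
  then show ?case using Cons by (simp add: proots_mult del: mult_pCons_left)
qed simp

text \<open>Similar matrices share the characteristic polynomial, so the diagonal \<open>d\<close>
  is a rearrangement of the sorted list of roots. The permutation \<open>p\<close> records at which
  position of \<open>d\<close> the j-th smallest eigenvalue sits.\<close>

lemma lap_eigenvalue_diagonalization:
  assumes U: "U \<in> carrier_mat n n" and UU: "transpose_mat U * U = 1\<^sub>m n"
    and L: "laplacian n G = U * mat_diag n d * transpose_mat U"
  obtains p where "p permutes {..<n}" "\<And>j. j < n \<Longrightarrow> lap_eigenvalue n G j = d (p j)"
    "\<And>i j. i \<le> j \<Longrightarrow> j < n \<Longrightarrow> lap_eigenvalue n G i \<le> lap_eigenvalue n G j"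
proof -
  have "U * transpose_mat U = 1\<^sub>m n"
    using U UU by (meson mat_mult_left_right_inverse transpose_carrier_mat)
  then have "similar_mat (laplacian n G) (mat_diag n d)"
    unfolding similar_mat_def using U UU L
    by (intro exI[of _ U] exI[of _ "transpose_mat U"], intro similar_mat_witI[of _ _ n]) auto
  then have "char_poly (laplacian n G) = (\<Prod>a\<leftarrow>diag_mat (mat_diag n d). [:- a, 1:])"
    by (simp add: char_poly_similar char_poly_upper_triangular[of _ n] upper_triangular_def
        mat_diag_def)
  also have "diag_mat (mat_diag n d) = map d [0..<n]"
    by (auto simp: diag_mat_def mat_diag_def)
  finally have mset: "mset (sorted_list_of_multiset (proots (char_poly (laplacian n G)))) =
      mset (map d [0..<n])"
    by (simp only: proots_prod_list_linear mset_sorted_list_of_multiset)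
  from mset obtain p where p: "p permutes {..<n}"
    "permute_list p (map d [0..<n]) =
      sorted_list_of_multiset (proots (char_poly (laplacian n G)))"
    by (rule mset_eq_permutation) simp
  have ev: "lap_eigenvalue n G j = d (p j)" if "j < n" for j
    unfolding lap_eigenvalue_def p(2)[symmetric]
    using that permutes_in_image[OF p(1), of j] by (simp add: permute_list_def)
  have "length (sorted_list_of_multiset (proots (char_poly (laplacian n G)))) = n"
    using arg_cong[OF mset, of size] unfolding size_mset by simp
  then have "lap_eigenvalue n G i \<le> lap_eigenvalue n G j" if "i \<le> j" "j < n" for i j
    unfolding lap_eigenvalue_def using that by (intro sorted_nth_mono) simp_all
  with p(1) ev show ?thesis by (rule that)
qed

lemma apply_mat_diagonalization:
  assumes U: "U \<in> carrier_mat n n" and B: "B = U * mat_diag n D * transpose_mat U"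
  shows "dotp n f (apply_mat n (1\<^sub>m n + B) f) =
    dotp n f f + (\<Sum>i<n. D i * (\<Sum>k<n. U $$ (k, i) * f (Suc k))\<^sup>2)"
proof -
  have Bc: "B \<in> carrier_mat n n"
    unfolding B using U by (intro mult_carrier_mat[of _ _ n]) auto
  have B_entry: "B $$ (k, l) = (\<Sum>i<n. U $$ (k, i) * D i * U $$ (l, i))" if "k < n" "l < n" for k l
    using that U unfolding B mat_diag_mult_right[OF U]
    by (auto simp: scalar_prod_def lessThan_atLeast0[symmetric])
  have "apply_mat n (1\<^sub>m n + B) f (Suc k) = f (Suc k) + (\<Sum>l<n. B $$ (k, l) * f (Suc l))"
    if "k < n" for k
    using that Bc
    by (auto simp: apply_mat_def scalar_prod_def lessThan_atLeast0[symmetric]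
        sum.distrib ring_distribs if_distrib[of "\<lambda>x. x * _"] cong: if_cong)
  then have "dotp n f (apply_mat n (1\<^sub>m n + B) f) =
      dotp n f f + (\<Sum>k<n. f (Suc k) * (\<Sum>l<n. B $$ (k, l) * f (Suc l)))"
    by (simp add: dotp_lessThan ring_distribs sum.distrib)
  also have "(\<Sum>k<n. f (Suc k) * (\<Sum>l<n. B $$ (k, l) * f (Suc l))) =
      (\<Sum>k<n. \<Sum>l<n. \<Sum>i<n. D i * (U $$ (k, i) * f (Suc k) * (U $$ (l, i) * f (Suc l))))"
    by (simp add: B_entry sum_distrib_left sum_distrib_right mult_ac)
  also have "\<dots> = (\<Sum>i<n. \<Sum>k<n. \<Sum>l<n. D i * (U $$ (k, i) * f (Suc k) * (U $$ (l, i) * f (Suc l))))"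
    by (subst (2) sum.swap, subst sum.swap) rule
  also have "\<dots> = (\<Sum>i<n. D i * (\<Sum>k<n. U $$ (k, i) * f (Suc k))\<^sup>2)"
    by (intro sum.cong refl, subst power2_eq_square, subst sum_product)
      (simp only: sum_distrib_left)
  finally show ?thesis .
qed

text \<open>The summand 1 of each weight comes from the identity matrix by Parseval. The order of
  the eigenvalues is exported together with the basis, because truncation at m only makes sense when
  \<open>u\<close> lists the eigenvectors in that order.\<close>

lemma sobolev_ball_spectral:
  assumes n: "n \<ge> 1"
    and sym: "\<And>k l. (k, l) \<in> parcs G \<Longrightarrow> (l, k) \<in> parcs G"
  obtains u where "orthonormal n u"
    "sobolev_ball n G r \<beta> Q = {f \<in> {1..n} \<rightarrow>\<^sub>E UNIV.
       (\<Sum>j<n. (1 + (real n powr (2 / r) * lap_eigenvalue n G j) powr \<beta>) * (dotp n (u j) f)\<^sup>2)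
         / real n \<le> Q\<^sup>2}"
    "\<And>i j. i \<le> j \<Longrightarrow> j < n \<Longrightarrow> lap_eigenvalue n G i \<le> lap_eigenvalue n G j"
proof -
  define c where "c = real n powr (2 / r)"
  have c: "c > 0" using n by (simp add: c_def)
  define M where "M = c \<cdot>\<^sub>m laplacian n G"
  have Lc: "laplacian n G \<in> carrier_mat n n"
    unfolding laplacian_def adjacency_mat_def by (intro minus_carrier_mat) simp
  then have Mc: "M \<in> carrier_mat n n" by (simp add: M_def)
  have Msym: "M $$ (k, l) = M $$ (l, k)" if "k < n" "l < n" for k l
    using that sym by (auto simp: M_def laplacian_def degree_mat_def adjacency_mat_def mat_diag_def)
  have "\<exists>B U d. U \<in> carrier_mat n n \<and> transpose_mat U * U = 1\<^sub>m n \<and>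
       M = U * mat_diag n d * transpose_mat U \<and>
       B = U * mat_diag n (\<lambda>i. d i powr \<beta>) * transpose_mat U"
    using symmetric_mat_diagonalization[OF Mc Msym] by metis
  \<comment> \<open>The pair \<open>U\<close>, \<open>d\<close> is one that witnesses the value
    chosen in \<open>mat_powr\<close>; the eigenvectors and the eigenvalues below are both read off
    from it.\<close>
  from someI_ex[OF this] obtain U d where U: "U \<in> carrier_mat n n"
    and UU: "transpose_mat U * U = 1\<^sub>m n"
    and M: "M = U * mat_diag n d * transpose_mat U"
    and P: "mat_powr M \<beta> = U * mat_diag n (\<lambda>i. d i powr \<beta>) * transpose_mat U"
    using Mc unfolding mat_powr_def Let_def by (auto simp only: carrier_matD)
  have "laplacian n G = (1 / c) \<cdot>\<^sub>m M"
    using c by (intro eq_matI) (auto simp: M_def)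
  then have L: "laplacian n G = U * mat_diag n (\<lambda>i. (1 / c) * d i) * transpose_mat U"
    unfolding M using smult_diagonalization[OF U] by simp
  obtain p where p: "p permutes {..<n}"
    and ev: "\<And>j. j < n \<Longrightarrow> lap_eigenvalue n G j = (1 / c) * d (p j)"
    and mono: "\<And>i j. i \<le> j \<Longrightarrow> j < n \<Longrightarrow> lap_eigenvalue n G i \<le> lap_eigenvalue n G j"
    using lap_eigenvalue_diagonalization[OF U UU L] by blast
  have pn: "p j < n" if "j < n" for j using permutes_in_image[OF p, of j] that by simp
  \<comment> \<open>Columns of \<open>U\<close> in the order of increasing eigenvalues;
    \<open>i - 1\<close> converts the vertex number into a row index.\<close>
  define u where "u j i = U $$ (i - 1, p j)" for j i
  have on: "orthonormal n u"
    unfolding orthonormal_def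
  proof (intro allI impI)
    fix j k assume jk: "j < n" "k < n"
    have "dotp n (u j) (u k) = (transpose_mat U * U) $$ (p j, p k)"
      using jk pn U by (simp add: dotp_lessThan u_def scalar_prod_def lessThan_atLeast0)
    also have "\<dots> = (if j = k then 1 else 0)"
      using jk pn UU permutes_inj[OF p] by (auto dest: injD)
    finally show "dotp n (u j) (u k) = (if j = k then 1 else 0)" .
  qed
  have "inner_n n f (apply_mat n (1\<^sub>m n + mat_powr M \<beta>) f) =
      (\<Sum>j<n. (1 + (c * lap_eigenvalue n G j) powr \<beta>) * (dotp n (u j) f)\<^sup>2) / real n" for f
  proof -
    have "(\<Sum>i<n. d i powr \<beta> * (\<Sum>k<n. U $$ (k, i) * f (Suc k))\<^sup>2) =
        (\<Sum>j<n. d (p j) powr \<beta> * (\<Sum>k<n. U $$ (k, p j) * f (Suc k))\<^sup>2)"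
      using sum.permute[OF p, of "\<lambda>i. d i powr \<beta> * (\<Sum>k<n. U $$ (k, i) * f (Suc k))\<^sup>2"]
      by (simp add: comp_def)
    also have "\<dots> = (\<Sum>j<n. (c * lap_eigenvalue n G j) powr \<beta> * (dotp n (u j) f)\<^sup>2)"
      using c by (intro sum.cong) (simp_all add: ev dotp_lessThan u_def)
    finally show ?thesis
      using apply_mat_diagonalization[OF U P, of f] parseval[OF on, of f]
      by (simp add: inner_n_dotp distrib_right sum.distrib)
  qed
  then show ?thesis
    using that[OF on _ mono] by (simp add: sobolev_ball_def M_def[symmetric] c_def[symmetric])
qed

section \<open>Gaussian noise\<close>

definition gauss :: "real measure" where
  "gauss = density lborel std_normal_density"

lemma noise_measure_gauss: "noise_measure n = PiM {1..n} (\<lambda>_. gauss)"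
  by (simp add: noise_measure_def gauss_def)

lemma sets_gauss [measurable_cong, simp]: "sets gauss = sets borel"
  by (simp add: gauss_def)

lemma space_gauss [simp]: "space gauss = UNIV"
  by (simp add: gauss_def)

lemma prob_space_gauss: "prob_space gauss"
  unfolding gauss_def by (rule prob_space_normal_density) simp

interpretation gauss: prob_space gauss by (rule prob_space_gauss)

interpretation gauss_prod: product_sigma_finite "\<lambda>_::nat. gauss"
  by (simp add: product_sigma_finite_def gauss.sigma_finite_measure_axioms)

lemma sets_noise_measure [measurable_cong, simp]:
  "sets (noise_measure n) = sets (PiM {1..n} (\<lambda>_. borel))"
  unfolding noise_measure_gauss by (intro sets_PiM_cong) simp_all

lemma space_noise_measure: "space (noise_measure n) = {1..n} \<rightarrow>\<^sub>E UNIV"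
  by (simp add: noise_measure_gauss space_PiM)

lemma prob_space_noise_measure: "prob_space (noise_measure n)"
  unfolding noise_measure_gauss by (rule prob_space_PiM) (rule prob_space_gauss)

lemma gauss_moments:
  "integrable gauss (\<lambda>x. x)" "integrable gauss (\<lambda>x. x\<^sup>2)"
  "(\<integral>x. x \<partial>gauss) = 0" "(\<integral>x. x\<^sup>2 \<partial>gauss) = 1"
proof -
  have "has_bochner_integral lborel (\<lambda>x. std_normal_density x * x ^ 1) 0"
    using std_normal_moment_odd[of 0] by simp
  moreover have "has_bochner_integral lborel (\<lambda>x. std_normal_density x * x\<^sup>2) 1"
    using std_normal_moment_even[of 1] by simp
  ultimately show "integrable gauss (\<lambda>x. x)" "integrable gauss (\<lambda>x. x\<^sup>2)"
    "(\<integral>x. x \<partial>gauss) = 0" "(\<integral>x. x\<^sup>2 \<partial>gauss) = 1"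
    by (auto simp: gauss_def integrable_density integral_density has_bochner_integral_iff
        normal_density_nonneg)
qed

lemma noise_covariance:
  assumes "i \<in> {1..n}" "k \<in> {1..n}"
  shows "integrable (noise_measure n) (\<lambda>\<xi>. \<xi> i * \<xi> k)"
    and "(\<integral>\<xi>. \<xi> i * \<xi> k \<partial>noise_measure n) = (if i = k then 1 else 0)"
proof -
  \<comment> \<open>Writes \<open>\<xi> i * \<xi> k\<close> as a product over all coordinates, so
    that Fubini treats the cases i = k (a square in one factor) and i different from k (two factors
    of mean 0) uniformly.\<close>
  define \<phi> where "\<phi> j x = (if j = i then x else 1) * (if j = k then x else 1::real)" for j x
  have prod: "(\<Prod>j\<in>{1..n}. \<phi> j (\<xi> j)) = \<xi> i * \<xi> k" for \<xi>
    using assms by (simp add: \<phi>_def prod.distrib)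
  have "integrable gauss (\<phi> j)" for j
    using gauss_moments(1,2)
    by (cases "j = i"; cases "j = k") (simp_all add: \<phi>_def[abs_def] power2_eq_square)
  then have "integrable (noise_measure n) (\<lambda>\<xi>. \<Prod>j\<in>{1..n}. \<phi> j (\<xi> j))"
    and int: "(\<integral>\<xi>. (\<Prod>j\<in>{1..n}. \<phi> j (\<xi> j)) \<partial>noise_measure n)
      = (\<Prod>j\<in>{1..n}. integral\<^sup>L gauss (\<phi> j))"
    unfolding noise_measure_gauss
    by (auto intro!: gauss_prod.product_integrable_prod gauss_prod.product_integral_prod)
  then show "integrable (noise_measure n) (\<lambda>\<xi>. \<xi> i * \<xi> k)" by (simp only: prod)
  have "(\<Prod>j\<in>{1..n}. integral\<^sup>L gauss (\<phi> j)) = (if i = k then 1 else 0)"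
  proof (cases "i = k")
    case True
    then have "integral\<^sup>L gauss (\<phi> j) = 1" for j
      using gauss_moments(4) gauss.prob_space
      by (cases "j = k") (simp_all add: \<phi>_def[abs_def] power2_eq_square)
    then show ?thesis using True by simp
  next
    case False
    then have "integral\<^sup>L gauss (\<phi> i) = 0"
      using gauss_moments(3) by (simp add: \<phi>_def[abs_def])
    then show ?thesis using False assms(1) by auto
  qed
  then show "(\<integral>\<xi>. \<xi> i * \<xi> k \<partial>noise_measure n) = (if i = k then 1 else 0)"
    using int by (simp only: prod)
qed

text \<open>Only the covariance enters. For a unit vector the second moment is 1, which gives the
  variance of the projection estimator and the mean of the likelihood ratio minorant in the
  two-point bound.\<close>

lemma noise_dotp_square:
  shows "integrable (noise_measure n) (\<lambda>\<xi>. (dotp n u \<xi>)\<^sup>2)"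
    and "(\<integral>\<xi>. (dotp n u \<xi>)\<^sup>2 \<partial>noise_measure n) = dotp n u u"
proof -
  have eq: "(dotp n u \<xi>)\<^sup>2 = (\<Sum>i\<in>{1..n}. \<Sum>k\<in>{1..n}. (u i * u k) * (\<xi> i * \<xi> k))" for \<xi>
    by (simp add: dotp_def power2_eq_square sum_product mult_ac)
  have cov: "has_bochner_integral (noise_measure n) (\<lambda>\<xi>. \<xi> i * \<xi> k) (if i = k then 1 else 0)"
    if "i \<in> {1..n}" "k \<in> {1..n}" for i k
    using noise_covariance[OF that] by (simp only: has_bochner_integral_iff simp_thms)
  have "has_bochner_integral (noise_measure n) (\<lambda>\<xi>. (dotp n u \<xi>)\<^sup>2)
      (\<Sum>i\<in>{1..n}. \<Sum>k\<in>{1..n}. (u i * u k) * (if i = k then 1 else 0))"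
    unfolding eq by (intro has_bochner_integral_sum has_bochner_integral_mult_right cov)
  also have "(\<Sum>i\<in>{1..n}. \<Sum>k\<in>{1..n}. (u i * u k) * (if i = k then 1 else 0)) = dotp n u u"
    by (simp add: dotp_def if_distrib[of "\<lambda>x. _ * x"] cong: if_cong)
  finally show "integrable (noise_measure n) (\<lambda>\<xi>. (dotp n u \<xi>)\<^sup>2)"
    "(\<integral>\<xi>. (dotp n u \<xi>)\<^sup>2 \<partial>noise_measure n) = dotp n u u"
    by (simp_all add: has_bochner_integral_iff)
qed

text \<open>Completing the square: the exponential factor is the likelihood ratio of the normal laws
  with means \<open>s\<close> and 0.\<close>

lemma gauss_shift:
  assumes [measurable]: "A \<in> sets borel"
  shows "(\<integral>\<^sup>+x. ennreal (exp (s * x - s\<^sup>2 / 2)) * indicator A x \<partial>gauss) =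
    emeasure gauss {x. x + s \<in> A}"
proof -
  have dens: "std_normal_density x * exp (s * x - s\<^sup>2 / 2) = std_normal_density (x - s)" for x
  proof -
    have "- (x - s)\<^sup>2 / 2 = - x\<^sup>2 / 2 + (s * x - s\<^sup>2 / 2)"
      by (simp add: power2_eq_square field_simps)
    then have "exp (- x\<^sup>2 / 2) * exp (s * x - s\<^sup>2 / 2) = exp (- (x - s)\<^sup>2 / 2)"
      by (simp only: exp_add)
    then show ?thesis by (simp add: std_normal_density_def)
  qed
  have "(\<integral>\<^sup>+x. ennreal (exp (s * x - s\<^sup>2 / 2)) * indicator A x \<partial>gauss) =
      (\<integral>\<^sup>+x. ennreal (std_normal_density x) * (ennreal (exp (s * x - s\<^sup>2 / 2)) * indicator A x) \<partial>lborel)"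
    unfolding gauss_def by (subst nn_integral_density) simp_all
  also have "\<dots> = (\<integral>\<^sup>+x. ennreal (std_normal_density (x - s)) * indicator A x \<partial>lborel)"
    by (simp add: dens[symmetric] ennreal_mult' normal_density_nonneg mult.assoc)
  also have "\<dots> = (\<integral>\<^sup>+x. ennreal (std_normal_density x) * indicator A (x + s) \<partial>lborel)"
    by (subst nn_integral_real_affine[where c = 1 and t = s]) (simp_all add: add.commute)
  also have "\<dots> = (\<integral>\<^sup>+x. ennreal (std_normal_density x) * indicator {x. x + s \<in> A} x \<partial>lborel)"
    by (intro nn_integral_cong) (simp add: indicator_def)
  also have "\<dots> = emeasure gauss {x. x + s \<in> A}"
    unfolding gauss_def by (subst emeasure_density) simp_all
  finally show ?thesis .
qed

text \<open>The Cameron-Martin formula in finite dimension. Both measures agree on boxes with the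
  product \<open>M'\<close> of the shifted one-dimensional laws; for the density this holds because
  its exponent is a sum over coordinates.\<close>

lemma distr_noise_shift:
  "distr (noise_measure n) (PiM {1..n} (\<lambda>_. borel)) (\<lambda>\<xi>. \<lambda>i\<in>{1..n}. \<xi> i + s i) =
   density (noise_measure n) (\<lambda>\<xi>. ennreal (exp (dotp n s \<xi> - dotp n s s / 2)))"
    (is "?L = ?R")
proof -
  define M' where "M' i = distr gauss borel (\<lambda>x. x + s i)" for i
  have [measurable]: "(\<lambda>x. x + s i) \<in> gauss \<rightarrow>\<^sub>M borel" for i by measurable
  have ps: "prob_space (M' i)" for i
    unfolding M'_def by (rule gauss.prob_space_distr) measurable
  interpret M': product_sigma_finite M'
    unfolding product_sigma_finite_def
    using ps prob_space_imp_sigma_finite by blast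
  have sets_M' [simp]: "sets (M' i) = sets borel" for i by (simp add: M'_def)
  have sets_eq: "sets (PiM {1..n} M') = sets (PiM {1..n} (\<lambda>_. borel))"
    by (intro sets_PiM_cong) simp_all
  have em_M': "emeasure (M' i) A = emeasure gauss {x. x + s i \<in> A}" if "A \<in> sets borel" for i A
    using that unfolding M'_def by (subst emeasure_distr) (auto simp: vimage_def)
  have "?L = PiM {1..n} M'"
  proof (rule M'.PiM_eqI)
    fix A assume "\<And>i. i \<in> {1..n} \<Longrightarrow> A i \<in> sets (M' i)"
    then have A: "A i \<in> sets borel" if "i \<in> {1..n}" for i using that by simp
    have sh: "{x. x + s i \<in> A i} \<in> sets gauss" if "i \<in> {1..n}" for i
      using measurable_sets[of "\<lambda>x. x + s i" gauss borel "A i"] A[OF that]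
      by (simp add: vimage_def)
    have "emeasure ?L (Pi\<^sub>E {1..n} A) =
        emeasure (noise_measure n)
          ((\<lambda>\<xi>. \<lambda>i\<in>{1..n}. \<xi> i + s i) -` Pi\<^sub>E {1..n} A \<inter> space (noise_measure n))"
      using A by (intro emeasure_distr sets_PiM_I_finite) simp_all
    also have "(\<lambda>\<xi>. \<lambda>i\<in>{1..n}. \<xi> i + s i) -` Pi\<^sub>E {1..n} A \<inter> space (noise_measure n) =
        Pi\<^sub>E {1..n} (\<lambda>i. {x. x + s i \<in> A i})"
      by (auto simp: space_noise_measure PiE_def Pi_def)
    also have "emeasure (noise_measure n) \<dots> = (\<Prod>i\<in>{1..n}. emeasure gauss {x. x + s i \<in> A i})"
      unfolding noise_measure_gauss using sh by (intro gauss_prod.emeasure_PiM) auto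
    also have "\<dots> = (\<Prod>i\<in>{1..n}. emeasure (M' i) (A i))"
      using A by (intro prod.cong) (simp_all add: em_M')
    finally show "emeasure ?L (Pi\<^sub>E {1..n} A) = (\<Prod>i\<in>{1..n}. emeasure (M' i) (A i))" .
  qed (simp, simp only: sets_eq sets_distr sets_density sets_noise_measure)
  moreover have "?R = PiM {1..n} M'"
  proof (rule M'.PiM_eqI)
    fix A assume "\<And>i. i \<in> {1..n} \<Longrightarrow> A i \<in> sets (M' i)"
    then have A: "A i \<in> sets borel" if "i \<in> {1..n}" for i using that by simp
    have [measurable]: "Pi\<^sub>E {1..n} A \<in> sets (noise_measure n)"
      unfolding sets_noise_measure using A by (intro sets_PiM_I_finite) simp_all
    have [measurable]: "(\<lambda>\<xi>. dotp n s \<xi>) \<in> borel_measurable (noise_measure n)"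
      unfolding dotp_def by measurable
    have "emeasure ?R (Pi\<^sub>E {1..n} A) =
       (\<integral>\<^sup>+\<xi>. ennreal (exp (dotp n s \<xi> - dotp n s s / 2)) * indicator (Pi\<^sub>E {1..n} A) \<xi> \<partial>noise_measure n)"
      by (intro emeasure_density) measurable
    also have "\<dots> = (\<integral>\<^sup>+\<xi>. (\<Prod>i\<in>{1..n}. ennreal (exp (s i * \<xi> i - (s i)\<^sup>2 / 2)) * indicator (A i) (\<xi> i))
        \<partial>noise_measure n)"
    proof (rule nn_integral_cong)
      fix \<xi> assume "\<xi> \<in> space (noise_measure n)"
      then have "indicator (Pi\<^sub>E {1..n} A) \<xi> = (\<Prod>i\<in>{1..n}. indicator (A i) (\<xi> i) :: ennreal)"
        by (auto simp: space_noise_measure indicator_def PiE_def Pi_def)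
      moreover have "ennreal (exp (dotp n s \<xi> - dotp n s s / 2)) =
          (\<Prod>i\<in>{1..n}. ennreal (exp (s i * \<xi> i - (s i)\<^sup>2 / 2)))"
        by (subst prod_ennreal)
          (simp_all add: exp_sum[symmetric] dotp_def sum_subtractf sum_divide_distrib power2_eq_square)
      ultimately show "ennreal (exp (dotp n s \<xi> - dotp n s s / 2)) * indicator (Pi\<^sub>E {1..n} A) \<xi> =
          (\<Prod>i\<in>{1..n}. ennreal (exp (s i * \<xi> i - (s i)\<^sup>2 / 2)) * indicator (A i) (\<xi> i))"
        by (simp add: prod.distrib)
    qed
    also have "\<dots> = (\<Prod>i\<in>{1..n}. \<integral>\<^sup>+x. ennreal (exp (s i * x - (s i)\<^sup>2 / 2)) * indicator (A i) x \<partial>gauss)"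
      unfolding noise_measure_gauss
    proof (rule gauss_prod.product_nn_integral_prod)
      fix i assume "i \<in> {1..n}"
      from A[OF this] have [measurable]: "A i \<in> sets borel" .
      show "(\<lambda>x. ennreal (exp (s i * x - (s i)\<^sup>2 / 2)) * indicator (A i) x) \<in> borel_measurable gauss"
        by measurable
    qed simp
    also have "\<dots> = (\<Prod>i\<in>{1..n}. emeasure (M' i) (A i))"
      using A by (intro prod.cong) (simp_all add: em_M' gauss_shift)
    finally show "emeasure ?R (Pi\<^sub>E {1..n} A) = (\<Prod>i\<in>{1..n}. emeasure (M' i) (A i))" .
  qed (simp, simp only: sets_eq sets_distr sets_density sets_noise_measure)
  ultimately show ?thesis by simp
qed

lemma nn_integral_noise_shift:
  assumes [measurable]: "h \<in> borel_measurable (PiM {1..n} (\<lambda>_. borel))"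
  shows "(\<integral>\<^sup>+\<xi>. h (\<lambda>i\<in>{1..n}. \<xi> i + s i) \<partial>noise_measure n) =
    (\<integral>\<^sup>+\<xi>. ennreal (exp (dotp n s \<xi> - dotp n s s / 2)) * h \<xi> \<partial>noise_measure n)"
proof -
  have [measurable]: "(\<lambda>\<xi>. dotp n s \<xi>) \<in> borel_measurable (noise_measure n)"
    unfolding dotp_def by measurable
  have "(\<integral>\<^sup>+\<xi>. h (\<lambda>i\<in>{1..n}. \<xi> i + s i) \<partial>noise_measure n) =
      (\<integral>\<^sup>+\<xi>. h \<xi> \<partial>distr (noise_measure n) (PiM {1..n} (\<lambda>_. borel)) (\<lambda>\<xi>. \<lambda>i\<in>{1..n}. \<xi> i + s i))"
    by (subst nn_integral_distr) measurable
  then show ?thesis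
    unfolding distr_noise_shift by (subst (asm) nn_integral_density) measurable
qed

section \<open>Upper bound for the risk on ellipsoids\<close>

lemma norm_n_square: "(norm_n n f)\<^sup>2 = dotp n f f / real n"
  by (simp add: norm_n_def inner_n_dotp dotp_def sum_nonneg)

lemma dotp_diff: "dotp n v (\<lambda>i. f i - g i) = dotp n v f - dotp n v g"
  by (simp add: dotp_def right_diff_distrib sum_subtractf)

lemma dotp_observation:
  "dotp n v (\<lambda>i\<in>{1..n}. f i + \<sigma> * \<xi> i) = dotp n v f + \<sigma> * dotp n v \<xi>"
  by (simp add: dotp_def distrib_left sum.distrib sum_distrib_left mult_ac)

lemma dotp_synthesis:
  assumes "orthonormal n u" "J \<subseteq> {..<n}" "k < n"
  shows "dotp n (u k) (\<lambda>i\<in>{1..n}. \<Sum>j\<in>J. c j * u j i) = (if k \<in> J then c k else 0)"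
proof -
  have "finite J" using assms(2) finite_subset by blast
  have "dotp n (u k) (\<lambda>i\<in>{1..n}. \<Sum>j\<in>J. c j * u j i) = (\<Sum>j\<in>J. c j * dotp n (u k) (u j))"
    unfolding dotp_def sum_distrib_left
    by (subst sum.swap) (simp add: sum_distrib_left mult_ac)
  also have "\<dots> = (\<Sum>j\<in>J. if j = k then c k else 0)"
    using assms by (intro sum.cong) (auto simp: orthonormal_def)
  also have "\<dots> = (if k \<in> J then c k else 0)" using \<open>finite J\<close> by simp
  finally show ?thesis .
qed

lemma measurable_observation [measurable]:
  "(\<lambda>\<xi>. \<lambda>i\<in>{1..n}. f i + \<sigma> * \<xi> i) \<in> noise_measure n \<rightarrow>\<^sub>M PiM {1..n} (\<lambda>_. borel)"
  for \<sigma> :: real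
  by (intro measurable_restrict borel_measurable_add borel_measurable_const
      borel_measurable_times) (simp_all add: measurable_cong_sets[OF sets_noise_measure refl])

lemma measurable_dotp [measurable]:
  "dotp n v \<in> borel_measurable (PiM {1..n} (\<lambda>_. borel))"
  unfolding dotp_def[abs_def] by measurable

lemma measurable_dotp_noise [measurable]: "dotp n v \<in> borel_measurable (noise_measure n)"
  using measurable_dotp by (simp only: measurable_cong_sets[OF sets_noise_measure refl])

lemma measurable_estimator_component:
  assumes "fhat \<in> estimators n" "i \<in> {1..n}"
  shows "(\<lambda>y. fhat y i) \<in> borel_measurable (PiM {1..n} (\<lambda>_. borel))"
  using measurable_compose[OF assms(1)[unfolded estimators_def] measurable_component_singleton]
    assms(2) by blast

text \<open>Moves the risks for all \<open>f\<close> onto the same noise space, where they can be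
  compared.\<close>

lemma risk_noise:
  assumes "fhat \<in> estimators n"
  shows "risk n \<sigma> fhat f = (\<integral>\<^sup>+ \<xi>. ennreal
    (let y = (\<lambda>i\<in>{1..n}. f i + \<sigma> * \<xi> i) in
      dotp n (\<lambda>i. fhat y i - f i) (\<lambda>i. fhat y i - f i) / real n) \<partial>noise_measure n)"
proof -
  have [measurable]: "(\<lambda>y. fhat y i) \<in> borel_measurable (PiM {1..n} (\<lambda>_. borel))"
    if "i \<in> {1..n}" for i
    using measurable_estimator_component[OF assms that] .
  have [measurable]: "(\<lambda>y. dotp n (\<lambda>i. fhat y i - f i) (\<lambda>i. fhat y i - f i)) \<in>
      borel_measurable (PiM {1..n} (\<lambda>_. borel))"
    unfolding dotp_def by (intro borel_measurable_sum) measurable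
  show ?thesis
    unfolding risk_def data_law_def norm_n_square Let_def
    by (subst nn_integral_distr) measurable
qed

text \<open>The estimator keeps the first m empirical coefficients. By Parseval its loss is, for
  each noise value, the noise energy in the kept coordinates plus the energy \<open>b\<close> of
  \<open>f\<close> in the dropped ones; \<open>b\<close> is deterministic and bounded through the
  weights, all at least \<open>W\<close> from index m on.\<close>

lemma minimax_risk_upper:
  assumes on: "orthonormal n u" and n: "n \<ge> 1" and m: "m \<le> n" and W: "W > 0"
    and wW: "\<And>j. m \<le> j \<Longrightarrow> j < n \<Longrightarrow> W \<le> w j"
    and w0: "\<And>j. j < n \<Longrightarrow> 0 \<le> w j"
    and F: "\<And>f. f \<in> F \<Longrightarrow> (\<Sum>j<n. w j * (dotp n (u j) f)\<^sup>2) / real n \<le> Q\<^sup>2"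
  shows "minimax_risk n \<sigma> F \<le> ennreal (\<sigma>\<^sup>2 * real m / real n + Q\<^sup>2 / W)"
proof -
  define fhat where "fhat y = (\<lambda>i\<in>{1..n}. \<Sum>j\<in>{..<m}. dotp n (u j) y * u j i)" for y
  have est: "fhat \<in> estimators n"
    unfolding fhat_def[abs_def] estimators_def by (intro measurable_restrict) measurable
  have coeff: "dotp n (u k) (fhat y) = (if k < m then dotp n (u k) y else 0)" if "k < n" for k y
    unfolding fhat_def using dotp_synthesis[OF on _ that, of "{..<m}"] m by auto
  have uu: "dotp n (u k) (u k) = 1" if "k < m" for k
    using on that m by (simp add: orthonormal_def)
  have "risk n \<sigma> fhat f \<le> ennreal (\<sigma>\<^sup>2 * real m / real n + Q\<^sup>2 / W)" if "f \<in> F" for f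
  proof -
    define b where "b = (\<Sum>k\<in>{m..<n}. (dotp n (u k) f)\<^sup>2)"
    have "W * b \<le> (\<Sum>k\<in>{m..<n}. w k * (dotp n (u k) f)\<^sup>2)"
      unfolding b_def sum_distrib_left using wW by (intro sum_mono mult_right_mono) auto
    also have "\<dots> \<le> (\<Sum>k<n. w k * (dotp n (u k) f)\<^sup>2)"
      using w0 by (intro sum_mono2) auto
    also have "\<dots> \<le> Q\<^sup>2 * real n" using F[OF that] n by (simp add: divide_simps)
    finally have b: "b / real n \<le> Q\<^sup>2 / W" using W n by (simp add: field_simps)
    have loss: "(let y = (\<lambda>i\<in>{1..n}. f i + \<sigma> * \<xi> i) in
        dotp n (\<lambda>i. fhat y i - f i) (\<lambda>i. fhat y i - f i) / real n) =
        \<sigma>\<^sup>2 / real n * (\<Sum>k<m. (dotp n (u k) \<xi>)\<^sup>2) + b / real n" for \<xi>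
    proof -
      define y where "y = (\<lambda>i\<in>{1..n}. f i + \<sigma> * \<xi> i)"
      have "dotp n (\<lambda>i. fhat y i - f i) (\<lambda>i. fhat y i - f i) =
          (\<Sum>k<n. (dotp n (u k) (\<lambda>i. fhat y i - f i))\<^sup>2)"
        by (rule parseval[OF on])
      also have "\<dots> = (\<Sum>k\<in>{..<m} \<union> {m..<n}. if k < m then \<sigma>\<^sup>2 * (dotp n (u k) \<xi>)\<^sup>2 else (dotp n (u k) f)\<^sup>2)"
        using m by (intro sum.cong)
          (auto simp: dotp_diff coeff y_def dotp_observation power_mult_distrib simp del: One_nat_def)
      also have "\<dots> = (\<Sum>k<m. \<sigma>\<^sup>2 * (dotp n (u k) \<xi>)\<^sup>2) + b"
        unfolding b_def by (subst sum.union_disjoint) auto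
      finally show ?thesis
        by (simp add: y_def[symmetric] Let_def add_divide_distrib sum_distrib_left[symmetric]
            del: One_nat_def)
    qed
    interpret prob_space "noise_measure n" by (rule prob_space_noise_measure)
    have int: "integrable (noise_measure n)
        (\<lambda>\<xi>. \<sigma>\<^sup>2 / real n * (\<Sum>k<m. (dotp n (u k) \<xi>)\<^sup>2) + b / real n)"
      by (intro Bochner_Integration.integrable_add integrable_const integrable_mult_right
          Bochner_Integration.integrable_sum noise_dotp_square(1))
    have b0: "0 \<le> b" unfolding b_def by (simp add: sum_nonneg)
    have "risk n \<sigma> fhat f =
        ennreal (\<integral>\<xi>. \<sigma>\<^sup>2 / real n * (\<Sum>k<m. (dotp n (u k) \<xi>)\<^sup>2) + b / real n \<partial>noise_measure n)"
      unfolding risk_noise[OF est] loss using b0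
      by (intro nn_integral_eq_integral int)
        (auto intro!: AE_I2 add_nonneg_nonneg divide_nonneg_nonneg mult_nonneg_nonneg sum_nonneg)
    also have "(\<integral>\<xi>. \<sigma>\<^sup>2 / real n * (\<Sum>k<m. (dotp n (u k) \<xi>)\<^sup>2) + b / real n \<partial>noise_measure n) =
        \<sigma>\<^sup>2 / real n * (\<Sum>k<m. dotp n (u k) (u k)) + b / real n"
      by (simp add: noise_dotp_square prob_space)
    also have "ennreal \<dots> \<le> ennreal (\<sigma>\<^sup>2 * real m / real n + Q\<^sup>2 / W)"
      using b uu by (intro ennreal_leI) simp
    finally show ?thesis .
  qed
  then show ?thesis
    unfolding minimax_risk_def by (intro INF_lower2[OF est] SUP_least)
qed

section \<open>Lower bound for the risk on hypercubes\<close>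

text \<open>Moving the signal by \<open>b * u\<close> amounts to moving the noise by
  \<open>b / \<sigma>\<close> times the unit vector \<open>u\<close>, so the likelihood ratio
  depends on the noise only through \<open>dotp n u \<xi>\<close>.\<close>

lemma nn_integral_observation_shift:
  fixes g :: "(nat \<Rightarrow> real) \<Rightarrow> ennreal"
  assumes [measurable]: "g \<in> borel_measurable (PiM {1..n} (\<lambda>_. borel))"
    and u: "dotp n u u = 1" and \<sigma>: "\<sigma> > 0"
  shows "(\<integral>\<^sup>+\<xi>. g (\<lambda>i\<in>{1..n}. f i + b * u i + \<sigma> * \<xi> i) \<partial>noise_measure n) =
    (\<integral>\<^sup>+\<xi>. ennreal (exp (b / \<sigma> * dotp n u \<xi> - (b / \<sigma>)\<^sup>2 / 2)) *
      g (\<lambda>i\<in>{1..n}. f i + \<sigma> * \<xi> i) \<partial>noise_measure n)"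
proof -
  define h where "h \<xi> = g (\<lambda>i\<in>{1..n}. f i + \<sigma> * \<xi> i)" for \<xi>
  have obs: "(\<lambda>\<xi>. \<lambda>i\<in>{1..n}. f i + \<sigma> * \<xi> i) \<in> PiM {1..n} (\<lambda>_. borel) \<rightarrow>\<^sub>M PiM {1..n} (\<lambda>_. borel)"
    using measurable_observation by (simp only: measurable_cong_sets[OF sets_noise_measure refl])
  have h: "h \<in> borel_measurable (PiM {1..n} (\<lambda>_. borel))"
    unfolding h_def[abs_def] by (rule measurable_compose[OF obs assms(1)])
  have "g (\<lambda>i\<in>{1..n}. f i + b * u i + \<sigma> * \<xi> i) = h (\<lambda>i\<in>{1..n}. \<xi> i + b / \<sigma> * u i)" for \<xi>
    unfolding h_def using \<sigma> by (intro arg_cong[of _ _ g]) (auto simp: field_simps)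
  moreover have "dotp n (\<lambda>i. b / \<sigma> * u i) \<xi> = b / \<sigma> * dotp n u \<xi>" for \<xi>
    by (simp add: dotp_def sum_distrib_left mult.assoc)
  moreover have "dotp n u (\<lambda>i. b / \<sigma> * u i) = b / \<sigma> * dotp n u u"
    by (simp add: dotp_def sum_distrib_left mult_ac)
  ultimately show ?thesis
    using nn_integral_noise_shift[OF h, of "\<lambda>i. b / \<sigma> * u i"]
    by (simp add: u h_def power2_eq_square)
qed

text \<open>Meant for integrands that take negative values, as the likelihood ratio minorant below
  does: \<open>ennreal\<close> cuts them off at 0, which can only increase the integral.\<close>

lemma ennreal_integral_le_nn_integral:
  assumes "integrable M f"
  shows "ennreal (\<integral>x. f x \<partial>M) \<le> (\<integral>\<^sup>+x. ennreal (f x) \<partial>M)"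
proof -
  have "(\<integral>x. f x \<partial>M) \<le> (\<integral>x. max 0 (f x) \<partial>M)"
    using assms by (intro integral_mono) auto
  then have "ennreal (\<integral>x. f x \<partial>M) \<le> ennreal (\<integral>x. max 0 (f x) \<partial>M)" by (rule ennreal_leI)
  also have "\<dots> = (\<integral>\<^sup>+x. ennreal (max 0 (f x)) \<partial>M)"
    using assms by (intro nn_integral_eq_integral[symmetric]) auto
  also have "\<dots> = (\<integral>\<^sup>+x. ennreal (f x) \<partial>M)"
    by (intro nn_integral_cong) (auto simp: max_def ennreal_neg)
  finally show ?thesis .
qed

text \<open>Relative to the midpoint \<open>f\<close> the two hypotheses have densities
  \<open>exp (t * Z - t\<^sup>2 / 2)\<close> and \<open>exp (- t * Z - t\<^sup>2 / 2)\<close>. A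
  common minorant \<open>B\<close> factors out, leaving
  \<open>(x - a)\<^sup>2 + (x + a)\<^sup>2 \<ge> 2 * a\<^sup>2\<close> whatever the estimate x is.
  The restriction on \<open>a\<close> gives \<open>t \<le> 1 / 2\<close>, which keeps the mean
  \<open>1 - t - t\<^sup>2 / 2\<close> of \<open>B\<close> above 1/4.\<close>

lemma two_point_lower_bound:
  fixes h :: "(nat \<Rightarrow> real) \<Rightarrow> real"
  assumes h [measurable]: "h \<in> borel_measurable (PiM {1..n} (\<lambda>_. borel))"
    and u: "dotp n u u = 1" and a: "0 \<le> a" "a \<le> \<sigma> / 2" and \<sigma>: "\<sigma> > 0"
  shows "ennreal (a\<^sup>2 / 2) \<le>
    (\<integral>\<^sup>+\<xi>. ennreal ((h (\<lambda>i\<in>{1..n}. f i + a * u i + \<sigma> * \<xi> i) - a)\<^sup>2) \<partial>noise_measure n) +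
    (\<integral>\<^sup>+\<xi>. ennreal ((h (\<lambda>i\<in>{1..n}. f i + - a * u i + \<sigma> * \<xi> i) - - a)\<^sup>2) \<partial>noise_measure n)"
    (is "_ \<le> ?I1 + ?I2")
proof -
  interpret prob_space "noise_measure n" by (rule prob_space_noise_measure)
  have shift: "(\<integral>\<^sup>+\<xi>. ennreal ((h (\<lambda>i\<in>{1..n}. f i + b * u i + \<sigma> * \<xi> i) - b)\<^sup>2) \<partial>noise_measure n) =
      (\<integral>\<^sup>+\<xi>. ennreal (exp (b / \<sigma> * dotp n u \<xi> - (b / \<sigma>)\<^sup>2 / 2)) *
        ennreal ((h (\<lambda>i\<in>{1..n}. f i + \<sigma> * \<xi> i) - b)\<^sup>2) \<partial>noise_measure n)" for b
    by (rule nn_integral_observation_shift[OF _ u \<sigma>, of "\<lambda>y. ennreal ((h y - b)\<^sup>2)"]) measurable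
  define t where "t = a / \<sigma>"
  have t: "0 \<le> t" "t \<le> 1 / 2" using a \<sigma> by (simp_all add: t_def field_simps)
  \<comment> \<open>\<open>B\<close> bounds both likelihood ratios from below, by \<open>exp y \<ge> 1 + y\<close> and \<open>\<bar>Z\<bar> \<le> (1 + Z\<^sup>2) / 2\<close>
    for \<open>Z = dotp n u \<xi>\<close>; its mean is known because \<open>Z\<close> has variance 1.\<close>
  define B where "B \<xi> = 1 - t / 2 - t\<^sup>2 / 2 - t / 2 * (dotp n u \<xi>)\<^sup>2" for \<xi>
  have B_int: "integrable (noise_measure n) (\<lambda>\<xi>. 2 * a\<^sup>2 * B \<xi>)"
    unfolding B_def
    by (intro integrable_mult_right Bochner_Integration.integrable_diff integrable_const
        noise_dotp_square(1))
  have "t\<^sup>2 \<le> 1 / 4" using power_mono[OF t(2,1), of 2] by (simp add: power2_eq_square)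
  then have "1 / 4 \<le> 1 - t - t\<^sup>2 / 2" using t by simp
  then have "2 * a\<^sup>2 * (1 / 4) \<le> 2 * a\<^sup>2 * (1 - t - t\<^sup>2 / 2)" by (intro mult_left_mono) auto
  also have "\<dots> = (\<integral>\<xi>. 2 * a\<^sup>2 * B \<xi> \<partial>noise_measure n)"
    unfolding B_def using noise_dotp_square[of n u]
    by (simp add: u prob_space)
  finally have "ennreal (a\<^sup>2 / 2) \<le> ennreal (\<integral>\<xi>. 2 * a\<^sup>2 * B \<xi> \<partial>noise_measure n)"
    by (intro ennreal_leI) simp
  also have "\<dots> \<le> (\<integral>\<^sup>+\<xi>. ennreal (2 * a\<^sup>2 * B \<xi>) \<partial>noise_measure n)"
    by (rule ennreal_integral_le_nn_integral[OF B_int])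
  also have "\<dots> \<le> (\<integral>\<^sup>+\<xi>. ennreal (exp (a / \<sigma> * dotp n u \<xi> - (a / \<sigma>)\<^sup>2 / 2)) *
        ennreal ((h (\<lambda>i\<in>{1..n}. f i + \<sigma> * \<xi> i) - a)\<^sup>2) +
      ennreal (exp (- a / \<sigma> * dotp n u \<xi> - (- a / \<sigma>)\<^sup>2 / 2)) *
        ennreal ((h (\<lambda>i\<in>{1..n}. f i + \<sigma> * \<xi> i) - - a)\<^sup>2) \<partial>noise_measure n)"
  proof (rule nn_integral_mono)
    fix \<xi>
    define Z where "Z = dotp n u \<xi>"
    define x where "x = h (\<lambda>i\<in>{1..n}. f i + \<sigma> * \<xi> i)"
    have "0 \<le> (1 - Z)\<^sup>2" "0 \<le> (1 + Z)\<^sup>2" by simp_all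
    then have Z: "- (1 + Z\<^sup>2) / 2 \<le> Z" "- (1 + Z\<^sup>2) / 2 \<le> - Z"
      by (simp_all add: power2_eq_square algebra_simps)
    have B: "B \<xi> = 1 + (t * (- (1 + Z\<^sup>2) / 2) - t\<^sup>2 / 2)"
      by (simp add: B_def Z_def field_simps)
    have E1: "B \<xi> \<le> exp (t * Z - t\<^sup>2 / 2)"
    proof -
      have "B \<xi> \<le> 1 + (t * Z - t\<^sup>2 / 2)"
        unfolding B using mult_left_mono[OF Z(1) t(1)] by linarith
      then show ?thesis using exp_ge_add_one_self order_trans by blast
    qed
    have E2: "B \<xi> \<le> exp (- t * Z - t\<^sup>2 / 2)"
    proof -
      have "B \<xi> \<le> 1 + (- t * Z - t\<^sup>2 / 2)"
        unfolding B using mult_left_mono[OF Z(2) t(1)] by linarith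
      then show ?thesis using exp_ge_add_one_self order_trans by blast
    qed
    have "2 * a\<^sup>2 * B \<xi> \<le> exp (t * Z - t\<^sup>2 / 2) * (x - a)\<^sup>2 + exp (- t * Z - t\<^sup>2 / 2) * (x + a)\<^sup>2"
    \<comment> \<open>Factoring out the minorant needs it to be nonnegative; elsewhere the left side
      is at most 0.\<close>
    proof (cases "B \<xi> \<le> 0")
      case True
      then have "2 * a\<^sup>2 * B \<xi> \<le> 0" by (intro mult_nonneg_nonpos) auto
      also have "0 \<le> exp (t * Z - t\<^sup>2 / 2) * (x - a)\<^sup>2 + exp (- t * Z - t\<^sup>2 / 2) * (x + a)\<^sup>2"
        by simp
      finally show ?thesis .
    next
      case False
      have "2 * a\<^sup>2 * B \<xi> \<le> B \<xi> * (2 * a\<^sup>2 + 2 * x\<^sup>2)" using False by (simp add: algebra_simps)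
      also have "\<dots> = B \<xi> * (x - a)\<^sup>2 + B \<xi> * (x + a)\<^sup>2"
        by (simp add: power2_eq_square algebra_simps)
      also have "\<dots> \<le> exp (t * Z - t\<^sup>2 / 2) * (x - a)\<^sup>2 + exp (- t * Z - t\<^sup>2 / 2) * (x + a)\<^sup>2"
        using E1 E2 by (intro add_mono mult_right_mono) auto
      finally show ?thesis .
    qed
    then have "ennreal (2 * a\<^sup>2 * B \<xi>) \<le>
        ennreal (exp (t * Z - t\<^sup>2 / 2) * (x - a)\<^sup>2 + exp (- t * Z - t\<^sup>2 / 2) * (x + a)\<^sup>2)"
      by (rule ennreal_leI)
    then show "ennreal (2 * a\<^sup>2 * B \<xi>) \<le>
      ennreal (exp (a / \<sigma> * dotp n u \<xi> - (a / \<sigma>)\<^sup>2 / 2)) *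
        ennreal ((h (\<lambda>i\<in>{1..n}. f i + \<sigma> * \<xi> i) - a)\<^sup>2) +
      ennreal (exp (- a / \<sigma> * dotp n u \<xi> - (- a / \<sigma>)\<^sup>2 / 2)) *
        ennreal ((h (\<lambda>i\<in>{1..n}. f i + \<sigma> * \<xi> i) - - a)\<^sup>2)"
      by (simp add: ennreal_plus ennreal_mult t_def[symmetric] Z_def[symmetric] x_def[symmetric]
          del: One_nat_def)
  qed
  also have "\<dots> = (\<integral>\<^sup>+\<xi>. ennreal (exp (a / \<sigma> * dotp n u \<xi> - (a / \<sigma>)\<^sup>2 / 2)) *
        ennreal ((h (\<lambda>i\<in>{1..n}. f i + \<sigma> * \<xi> i) - a)\<^sup>2) \<partial>noise_measure n) +
      (\<integral>\<^sup>+\<xi>. ennreal (exp (- a / \<sigma> * dotp n u \<xi> - (- a / \<sigma>)\<^sup>2 / 2)) *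
        ennreal ((h (\<lambda>i\<in>{1..n}. f i + \<sigma> * \<xi> i) - - a)\<^sup>2) \<partial>noise_measure n)"
    by (rule nn_integral_add) measurable
  also have "\<dots> = ?I1 + ?I2"
    by (simp only: shift)
  finally show ?thesis .
qed

text \<open>The supremum dominates the average over the cube. For a fixed coordinate the vertices
  fall into \<open>2 ^ (card J - 1)\<close> pairs differing only there, each contributing at least
  \<open>a\<^sup>2 / 2\<close>; per vertex this is \<open>a\<^sup>2 / 4\<close>.\<close>

lemma minimax_risk_lower:
  assumes on: "orthonormal n u" and n: "n \<ge> 1" and J: "J \<subseteq> {..<n}"
    and \<sigma>: "\<sigma> > 0" and a: "0 \<le> a" "a \<le> \<sigma> / 2"
    and cube: "\<And>T. T \<subseteq> J \<Longrightarrow>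
      (\<lambda>i\<in>{1..n}. \<Sum>j\<in>J. (if j \<in> T then a else - a) * u j i) \<in> F"
  shows "ennreal (real (card J) * a\<^sup>2 / (4 * real n)) \<le> minimax_risk n \<sigma> F"
  unfolding minimax_risk_def
proof (rule INF_greatest)
  fix fhat assume est: "fhat \<in> estimators n"
  have finJ: "finite J" using J finite_subset by blast
  define \<theta> where "\<theta> T j = (if j \<in> T then a else - a)" for T and j :: nat
  define fT where "fT T = (\<lambda>i\<in>{1..n}. \<Sum>j\<in>J. \<theta> T j * u j i)" for T
  have fT: "fT T \<in> F" if "T \<subseteq> J" for T
    using cube[OF that] by (simp add: fT_def \<theta>_def)
  define h where "h j y = dotp n (u j) (fhat y)" for j y
  have h_meas: "h j \<in> borel_measurable (PiM {1..n} (\<lambda>_. borel))" for j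
    unfolding h_def[abs_def] dotp_def
    by (intro borel_measurable_sum borel_measurable_times borel_measurable_const
        measurable_estimator_component[OF est])
  define g where "g j T = (\<integral>\<^sup>+\<xi>. ennreal ((h j (\<lambda>i\<in>{1..n}. fT T i + \<sigma> * \<xi> i) - \<theta> T j)\<^sup>2)
      \<partial>noise_measure n)" for j T
  have g_meas: "(\<lambda>\<xi>. ennreal ((h j (\<lambda>i\<in>{1..n}. fT T i + \<sigma> * \<xi> i) - \<theta> T j)\<^sup>2))
      \<in> borel_measurable (noise_measure n)" for j T
    using measurable_compose[OF measurable_observation h_meas] by measurable
  \<comment> \<open>Parseval for the error, with the coordinates outside \<open>J\<close>
    discarded.\<close>
  have risk_ge: "(\<Sum>j\<in>J. g j T) * ennreal (1 / real n) \<le> risk n \<sigma> fhat (fT T)" for T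
  proof -
    have coord: "dotp n (u j) (fT T) = \<theta> T j" if "j \<in> J" for j
      using dotp_synthesis[OF on J, of j "\<theta> T"] that J by (auto simp: fT_def)
    have "(\<Sum>j\<in>J. g j T) * ennreal (1 / real n) =
        (\<integral>\<^sup>+\<xi>. (\<Sum>j\<in>J. ennreal ((h j (\<lambda>i\<in>{1..n}. fT T i + \<sigma> * \<xi> i) - \<theta> T j)\<^sup>2)) *
          ennreal (1 / real n) \<partial>noise_measure n)"
      unfolding g_def
      by (subst nn_integral_sum[symmetric], rule g_meas, subst nn_integral_multc)
        (intro borel_measurable_sum g_meas, rule refl)
    also have "\<dots> \<le> risk n \<sigma> fhat (fT T)"
      unfolding risk_noise[OF est] Let_def
    proof (rule nn_integral_mono)
      fix \<xi>
      define y where "y = (\<lambda>i\<in>{1..n}. fT T i + \<sigma> * \<xi> i)"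
      have "(\<Sum>j\<in>J. (h j y - \<theta> T j)\<^sup>2) = (\<Sum>j\<in>J. (dotp n (u j) (\<lambda>i. fhat y i - fT T i))\<^sup>2)"
        by (intro sum.cong) (simp_all add: dotp_diff h_def coord)
      also have "\<dots> \<le> (\<Sum>j<n. (dotp n (u j) (\<lambda>i. fhat y i - fT T i))\<^sup>2)"
        using J by (intro sum_mono2) auto
      also have "\<dots> = dotp n (\<lambda>i. fhat y i - fT T i) (\<lambda>i. fhat y i - fT T i)"
        by (rule parseval[OF on, symmetric])
      finally have "(\<Sum>j\<in>J. (h j y - \<theta> T j)\<^sup>2) * (1 / real n) \<le>
          dotp n (\<lambda>i. fhat y i - fT T i) (\<lambda>i. fhat y i - fT T i) / real n"
        by (simp add: divide_right_mono)
      moreover have "(\<Sum>j\<in>J. ennreal ((h j y - \<theta> T j)\<^sup>2)) * ennreal (1 / real n) =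
          ennreal ((\<Sum>j\<in>J. (h j y - \<theta> T j)\<^sup>2) * (1 / real n))"
        by (subst sum_ennreal) (simp_all add: ennreal_mult'' del: times_divide_eq_right)
      ultimately show "(\<Sum>j\<in>J. ennreal ((h j (\<lambda>i\<in>{1..n}. fT T i + \<sigma> * \<xi> i) - \<theta> T j)\<^sup>2)) *
          ennreal (1 / real n) \<le>
        ennreal (dotp n (\<lambda>i. fhat (\<lambda>i\<in>{1..n}. fT T i + \<sigma> * \<xi> i) i - fT T i)
          (\<lambda>i. fhat (\<lambda>i\<in>{1..n}. fT T i + \<sigma> * \<xi> i) i - fT T i) / real n)"
        unfolding y_def[symmetric] by (simp only: ennreal_leI)
    qed
    finally show ?thesis .
  qed
  have pair: "ennreal (a\<^sup>2 / 2) \<le> g j T + g j (insert j T)" if "j \<in> J" "T \<subseteq> J - {j}" for j T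
  proof -
    \<comment> \<open>The midpoint of the pair: coordinate j is 0, the others keep their
      signs.\<close>
    define f0 where "f0 i = (\<Sum>k\<in>J - {j}. \<theta> T k * u k i)" for i
    have "(\<Sum>k\<in>J - {j}. \<theta> (insert j T) k * u k i) = f0 i" for i
      unfolding f0_def by (intro sum.cong) (auto simp: \<theta>_def)
    then have plus: "fT (insert j T) i = f0 i + a * u j i" if "i \<in> {1..n}" for i
      using that \<open>j \<in> J\<close> finJ by (simp add: fT_def sum.remove[of J j] \<theta>_def[of "insert j T" j])
    have minus: "fT T i = f0 i + - a * u j i" if "i \<in> {1..n}" for i
      using that \<open>j \<in> J\<close> \<open>T \<subseteq> J - {j}\<close> finJ
      by (auto simp: fT_def sum.remove[of J j] f0_def \<theta>_def[of T j])
    have "(\<lambda>i\<in>{1..n}. fT (insert j T) i + \<sigma> * \<xi> i) = (\<lambda>i\<in>{1..n}. f0 i + a * u j i + \<sigma> * \<xi> i)"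
      "(\<lambda>i\<in>{1..n}. fT T i + \<sigma> * \<xi> i) = (\<lambda>i\<in>{1..n}. f0 i + - a * u j i + \<sigma> * \<xi> i)" for \<xi>
      using plus minus by (auto intro!: restrict_ext)
    moreover have "\<theta> (insert j T) j = a" "\<theta> T j = - a"
      using that by (auto simp: \<theta>_def)
    moreover have "dotp n (u j) (u j) = 1"
      using on J \<open>j \<in> J\<close> by (auto simp: orthonormal_def)
    ultimately show ?thesis
      using two_point_lower_bound[OF h_meas, of "u j" a \<sigma> j f0] a \<sigma>
      by (simp only: g_def add.commute)
  qed
  have coord_sum: "ennreal (2 ^ card J * (a\<^sup>2 / 4)) \<le> (\<Sum>T\<in>Pow J. g j T)" if j: "j \<in> J" for j
  proof -
    have inj: "inj_on (insert j) (Pow (J - {j}))" by (auto simp: inj_on_def)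
    have PowJ: "Pow J = Pow (J - {j}) \<union> insert j ` Pow (J - {j})"
      using Pow_insert[of j "J - {j}"] j by (simp add: insert_absorb)
    have "card J = Suc (card (J - {j}))"
      using finJ j by (metis card.remove)
    then have "2 ^ card J * (a\<^sup>2 / 4) = real (card (Pow (J - {j}))) * (a\<^sup>2 / 2)"
      using finJ by (simp add: card_Pow)
    then have "ennreal (2 ^ card J * (a\<^sup>2 / 4)) = of_nat (card (Pow (J - {j}))) * ennreal (a\<^sup>2 / 2)"
      by (simp only: ennreal_of_nat_eq_real_of_nat ennreal_mult' of_nat_0_le_iff)
    also have "\<dots> \<le> (\<Sum>T\<in>Pow (J - {j}). g j T + g j (insert j T))"
      using pair[OF j] by (intro sum_bounded_below) auto
    also have "\<dots> = (\<Sum>T\<in>Pow (J - {j}). g j T) + (\<Sum>T\<in>insert j ` Pow (J - {j}). g j T)"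
      by (simp add: sum.distrib sum.reindex[OF inj])
    also have "\<dots> = (\<Sum>T\<in>Pow J. g j T)"
      unfolding PowJ using finJ by (intro sum.union_disjoint[symmetric]) auto
    finally show ?thesis .
  qed
  have card_cube: "ennreal (2 ^ card J) = of_nat (card (Pow J))"
    unfolding ennreal_of_nat_eq_real_of_nat using finJ by (simp add: card_Pow)
  \<comment> \<open>Sums over the vertices replace averages, so that \<open>ennreal\<close> needs no
    division; the factor \<open>2 ^ card J\<close> is cancelled at the end.\<close>
  have "ennreal (2 ^ card J) * ennreal (real (card J) * a\<^sup>2 / (4 * real n)) =
      of_nat (card J) * ennreal (2 ^ card J * (a\<^sup>2 / 4)) * ennreal (1 / real n)"
    by (simp add: ennreal_of_nat_eq_real_of_nat ennreal_mult'[symmetric] field_simps)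
  also have "\<dots> \<le> (\<Sum>j\<in>J. \<Sum>T\<in>Pow J. g j T) * ennreal (1 / real n)"
    using coord_sum by (intro mult_right_mono sum_bounded_below) auto
  also have "\<dots> = (\<Sum>T\<in>Pow J. (\<Sum>j\<in>J. g j T) * ennreal (1 / real n))"
    by (subst sum.swap) (simp add: sum_distrib_right)
  also have "\<dots> \<le> (\<Sum>T\<in>Pow J. SUP f\<in>F. risk n \<sigma> fhat f)"
    using risk_ge fT by (intro sum_mono order_trans[OF risk_ge] SUP_upper) auto
  also have "\<dots> = ennreal (2 ^ card J) * (SUP f\<in>F. risk n \<sigma> fhat f)"
    by (simp add: card_cube)
  finally show "ennreal (real (card J) * a\<^sup>2 / (4 * real n)) \<le> (SUP f\<in>F. risk n \<sigma> fhat f)"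
    by (subst (asm) ennreal_mult_le_mult_iff) simp_all
qed

section \<open>The minimax rate\<close>

lemma asymp_orderI:
  fixes b :: "nat \<Rightarrow> real"
  assumes k: "k > 0" and b: "\<forall>\<^sub>F n in sequentially. b n > 0"
    and lower: "\<forall>\<^sub>F n in sequentially. ennreal (k * b n) \<le> A n"
    and upper: "\<forall>\<^sub>F n in sequentially. A n \<le> ennreal (K * b n)"
  shows "asymp_order A (\<lambda>n. ennreal (b n))"
proof -
  have quot: "ennreal (c * b n) / ennreal (b n) = ennreal c" if "b n > 0" "c \<ge> 0" for c n
    using that by (subst divide_ennreal) auto
  have "\<forall>\<^sub>F n in sequentially. ennreal k \<le> A n / ennreal (b n)"
    using b lower
  proof eventually_elim
    case (elim n)
    then show ?case
      using divide_right_mono_ennreal[of "ennreal (k * b n)" "A n" "ennreal (b n)"] k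
      by (simp add: quot)
  qed
  then have "ennreal k \<le> liminf (\<lambda>n. A n / ennreal (b n))" by (rule Liminf_bounded)
  \<comment> \<open>The sign of \<open>K\<close> is not prescribed, while \<open>quot\<close> asks
    for a nonnegative constant; hence the absolute value.\<close>
  moreover have "\<forall>\<^sub>F n in sequentially. A n / ennreal (b n) \<le> ennreal \<bar>K\<bar>"
    using b upper
  proof eventually_elim
    case (elim n)
    then have "A n \<le> ennreal (\<bar>K\<bar> * b n)"
      by (elim order_trans) (intro ennreal_leI mult_right_mono; simp)
    then show ?case
      using divide_right_mono_ennreal[of "A n" "ennreal (\<bar>K\<bar> * b n)" "ennreal (b n)"] elim(1)
      by (simp add: quot)
  qed
  then have "limsup (\<lambda>n. A n / ennreal (b n)) \<le> ennreal \<bar>K\<bar>" by (rule Limsup_bounded)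
  moreover have "liminf (\<lambda>n. A n / ennreal (b n)) \<le> limsup (\<lambda>n. A n / ennreal (b n))"
    by (intro Liminf_le_Limsup) simp
  ultimately show ?thesis
    using k unfolding asymp_order_def
    by (auto intro: less_le_trans[of 0 "ennreal k"] le_less_trans[of _ "ennreal \<bar>K\<bar>"])
qed

text \<open>The scaling of the Laplacian cancels the n inside the geometry assumption, so the bounds
  on the weights depend on the index alone.\<close>

lemma scaled_powr:
  fixes r :: real
  assumes "n \<ge> 1"
  shows "real n powr (2 / r) * (C * (real i / real n) powr (2 / r)) = C * real i powr (2 / r)"
  using assms by (simp add: powr_divide)

text \<open>One eigenvalue bound at m suffices: monotonicity passes it on to every later index,
  including those beyond the range of the geometry assumption. Eigenvalues are numbered from 0, so m
  is exactly the first index dropped.\<close>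

lemma minimax_risk_sobolev_upper:
  assumes n: "n \<ge> 1" and sym: "\<And>k l. (k, l) \<in> parcs G \<Longrightarrow> (l, k) \<in> parcs G"
    and m: "1 \<le> m" "m < n" and C: "C > 0" and \<beta>: "\<beta> > 0"
    and ev: "C * (real m / real n) powr (2 / r) \<le> lap_eigenvalue n G m"
  shows "minimax_risk n \<sigma> (sobolev_ball n G r \<beta> Q) \<le>
    ennreal (\<sigma>\<^sup>2 * real m / real n + Q\<^sup>2 / (C powr \<beta> * real m powr (2 * \<beta> / r)))"
proof (rule sobolev_ball_spectral[OF n sym, of r \<beta> Q])
  fix u
  assume on: "orthonormal n u" and ball: "sobolev_ball n G r \<beta> Q =
    {f \<in> {1..n} \<rightarrow>\<^sub>E UNIV.
      (\<Sum>j<n. (1 + (real n powr (2 / r) * lap_eigenvalue n G j) powr \<beta>) * (dotp n (u j) f)\<^sup>2)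
        / real n \<le> Q\<^sup>2}"
    and mono: "\<And>i j. i \<le> j \<Longrightarrow> j < n \<Longrightarrow> lap_eigenvalue n G i \<le> lap_eigenvalue n G j"
  show ?thesis
  proof (rule minimax_risk_upper[OF on n])
    fix j assume j: "m \<le> j" "j < n"
    have "C * real m powr (2 / r) \<le> real n powr (2 / r) * lap_eigenvalue n G m"
      using mult_left_mono[OF ev, of "real n powr (2 / r)"] scaled_powr[OF n] by simp
    also have "\<dots> \<le> real n powr (2 / r) * lap_eigenvalue n G j"
      using mono[OF j] by (intro mult_left_mono) auto
    finally have "(C * real m powr (2 / r)) powr \<beta> \<le>
        (real n powr (2 / r) * lap_eigenvalue n G j) powr \<beta>"
      using C \<beta> by (intro powr_mono2) auto
    then show "C powr \<beta> * real m powr (2 * \<beta> / r) \<le>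
        1 + (real n powr (2 / r) * lap_eigenvalue n G j) powr \<beta>"
      using C by (simp add: powr_mult powr_powr mult_ac)
  qed (use m C in \<open>auto simp: ball add_nonneg_nonneg\<close>)
qed

text \<open>All vertices of the cube have the same energy, since signs disappear in the squares.
  Bounding every weight by its bound at m and \<open>card J\<close> by m leads to the third
  condition on \<open>a\<close>. Nonnegative eigenvalues make the power monotone.\<close>

lemma minimax_risk_sobolev_lower:
  assumes n: "n \<ge> 1" and sym: "\<And>k l. (k, l) \<in> parcs G \<Longrightarrow> (l, k) \<in> parcs G"
    and J: "J \<subseteq> {1..m}" "m < n" and C: "C \<ge> 0" and \<beta>: "\<beta> > 0" and r: "r > 0" and \<sigma>: "\<sigma> > 0"
    and ev: "\<And>j. j \<in> J \<Longrightarrow> 0 \<le> lap_eigenvalue n G j"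
      "\<And>j. j \<in> J \<Longrightarrow> lap_eigenvalue n G j \<le> C * (real j / real n) powr (2 / r)"
    and a: "0 \<le> a" "a \<le> \<sigma> / 2"
      "real m * a\<^sup>2 * (1 + C powr \<beta> * real m powr (2 * \<beta> / r)) \<le> Q\<^sup>2 * real n"
  shows "ennreal (real (card J) * a\<^sup>2 / (4 * real n)) \<le>
    minimax_risk n \<sigma> (sobolev_ball n G r \<beta> Q)"
proof -
  obtain u where on: "orthonormal n u" and ball: "sobolev_ball n G r \<beta> Q =
      {f \<in> {1..n} \<rightarrow>\<^sub>E UNIV.
        (\<Sum>j<n. (1 + (real n powr (2 / r) * lap_eigenvalue n G j) powr \<beta>) * (dotp n (u j) f)\<^sup>2)
          / real n \<le> Q\<^sup>2}"
    by (rule sobolev_ball_spectral[OF n sym])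
  define w where "w j = 1 + (real n powr (2 / r) * lap_eigenvalue n G j) powr \<beta>" for j
  have Jn: "J \<subseteq> {..<n}" using J by auto
  have w: "w j \<le> 1 + C powr \<beta> * real m powr (2 * \<beta> / r)" if "j \<in> J" for j
  proof -
    have "real n powr (2 / r) * lap_eigenvalue n G j \<le> C * real j powr (2 / r)"
      using mult_left_mono[OF ev(2)[OF that], of "real n powr (2 / r)"] scaled_powr[OF n] by simp
    also have "\<dots> \<le> C * real m powr (2 / r)"
      using J that C r by (intro mult_left_mono powr_mono2) auto
    finally have "(real n powr (2 / r) * lap_eigenvalue n G j) powr \<beta> \<le>
        (C * real m powr (2 / r)) powr \<beta>"
      using ev(1)[OF that] \<beta> by (intro powr_mono2) auto
    also have "\<dots> = C powr \<beta> * real m powr (2 * \<beta> / r)"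
      using C by (simp add: powr_mult powr_powr mult_ac)
    finally show ?thesis by (simp add: w_def)
  qed
  show ?thesis
  proof (rule minimax_risk_lower[OF on n Jn \<sigma> a(1,2)])
    fix T
    define f where "f = (\<lambda>i\<in>{1..n}. \<Sum>j\<in>J. (if j \<in> T then a else - a) * u j i)"
    have coord: "(dotp n (u k) f)\<^sup>2 = (if k \<in> J then a\<^sup>2 else 0)" if "k < n" for k
      unfolding f_def dotp_synthesis[OF on Jn that] by simp
    have "(\<Sum>j<n. w j * (dotp n (u j) f)\<^sup>2) = (\<Sum>j\<in>J. w j * a\<^sup>2)"
      using Jn by (simp add: coord if_distrib[of "\<lambda>x. _ * x"] sum.If_cases Int_absorb1 cong: if_cong)
    also have "\<dots> \<le> of_nat (card J) * ((1 + C powr \<beta> * real m powr (2 * \<beta> / r)) * a\<^sup>2)"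
      using w by (intro sum_bounded_above mult_right_mono) auto
    also have "\<dots> \<le> real m * ((1 + C powr \<beta> * real m powr (2 * \<beta> / r)) * a\<^sup>2)"
      using card_mono[OF _ J(1)] by (intro mult_right_mono) (auto intro!: mult_nonneg_nonneg add_nonneg_nonneg)
    also have "\<dots> \<le> Q\<^sup>2 * real n" using a(3) by (simp add: mult_ac)
    finally have "(\<Sum>j<n. w j * (dotp n (u j) f)\<^sup>2) / real n \<le> Q\<^sup>2"
      using n by (simp add: divide_simps)
    then have "f \<in> sobolev_ball n G r \<beta> Q"
      unfolding ball w_def[symmetric] by (simp add: f_def)
    then show "(\<lambda>i\<in>{1..n}. \<Sum>j\<in>J. (if j \<in> T then a else - a) * u j i) \<in> sobolev_ball n G r \<beta> Q"
      by (simp only: f_def)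
  qed
qed

theorem theorem3p1:
  fixes G :: "nat \<Rightarrow> nat pair_pre_digraph" and r \<sigma> :: real
  assumes "\<forall>n\<ge>1. pair_graph (G n) \<and> pverts (G n) = {1..n} \<and>
             Digraph_Component.connected (with_proj (G n))"
    and "r \<ge> 1"
    and "geometry_assumption r G"
    and "\<sigma> > 0"
  shows "\<forall>\<beta>>0. \<forall>Q>0.
           asymp_order (\<lambda>n. minimax_risk n \<sigma> (sobolev_ball n (G n) r \<beta> Q))
             (\<lambda>n. ennreal (real n powr (- 2 * \<beta> / (2 * \<beta> + r))))"
proof (intro allI impI)
  fix \<beta> Q :: real assume \<beta>: "\<beta> > 0" and Q: "Q > 0"
  have sym: "(l, k) \<in> parcs (G n)" if "n \<ge> 1" "(k, l) \<in> parcs (G n)" for n k l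
  proof -
    interpret pair_graph "G n" using assms(1) that(1) by blast
    show ?thesis using that(2) by (simp add: arcs_symmetric)
  qed
  obtain i0 \<kappa> C1 C2 where \<kappa>: "0 < \<kappa>" "\<kappa> \<le> 1" and C: "0 < C1" "0 < C2"
    and geo: "\<forall>\<^sub>F n in sequentially. \<forall>i::nat. i0 \<le> i \<and> real i \<le> \<kappa> * real n \<and> i < n \<longrightarrow>
             C1 * (real i / real n) powr (2 / r) \<le> lap_eigenvalue n (G n) i \<and>
             lap_eigenvalue n (G n) i \<le> C2 * (real i / real n) powr (2 / r)"
    using assms(3) unfolding geometry_assumption_def by (elim exE conjE) (rule that; assumption)
  \<comment> \<open>The exponent solves the balance equation: for \<open>x = n powr \<delta>\<close>
    both \<open>x / n\<close> and \<open>x powr (- 2 * \<beta> / r)\<close> equal the rate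
    \<open>b\<close>.\<close>
  define \<delta> where "\<delta> = r / (2 * \<beta> + r)"
  have \<delta>: "0 < \<delta>" "\<delta> < 1" using \<beta> assms(2) by (simp_all add: \<delta>_def)
  define x where "x n = real n powr \<delta>" for n
  define b where "b n = real n powr (- 2 * \<beta> / (2 * \<beta> + r))" for n
  define m where "m n = nat \<lceil>x n\<rceil>" for n
  have bx: "x n / real n = b n" "b n * x n powr (2 * \<beta> / r) = 1" if "n \<ge> 1" for n
  proof -
    have e: "\<delta> - 1 = - 2 * \<beta> / (2 * \<beta> + r)" "\<delta> * (2 * \<beta> / r) = - (- 2 * \<beta> / (2 * \<beta> + r))"
      using \<beta> assms(2) by (simp_all add: \<delta>_def field_simps)
    have "x n / real n = real n powr (\<delta> - 1)"
      using that by (simp add: x_def powr_diff)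
    then show "x n / real n = b n" by (simp only: e b_def)
    have "x n powr (2 * \<beta> / r) = real n powr (- (- 2 * \<beta> / (2 * \<beta> + r)))"
      unfolding x_def powr_powr e ..
    then show "b n * x n powr (2 * \<beta> / r) = 1"
      unfolding b_def using that by (simp only: powr_add[symmetric]) simp
  qed
  have x_top: "filterlim x at_top sequentially"
    unfolding x_def using \<delta>(1) by real_asymp
  have b_0: "b \<longlonglongrightarrow> 0"
  proof -
    have "- 2 * \<beta> / (2 * \<beta> + r) < 0" using \<beta> assms(2) by (simp add: field_simps)
    then show ?thesis unfolding b_def by real_asymp
  qed
  \<comment> \<open>The bound on \<open>b n\<close> yields
    \<open>2 * x n \<le> \<kappa> * n\<close>, so the rounded cutoff, below \<open>2 * x n\<close>,
    stays inside the geometry window and below n. The bound on \<open>i0\<close> leaves at least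
    \<open>x n / 2\<close> usable directions.\<close>
  have ev: "\<forall>\<^sub>F n in sequentially. n \<ge> 1 \<and> real i0 \<le> x n / 4 \<and> x n \<ge> 4 \<and> b n < \<kappa> / 2"
  proof -
    have "\<forall>\<^sub>F n in sequentially. x n \<ge> max 4 (4 * real i0)"
      using x_top unfolding filterlim_at_top by blast
    moreover have "\<forall>\<^sub>F n in sequentially. b n < \<kappa> / 2"
      using order_tendstoD(2)[OF b_0, of "\<kappa> / 2"] \<kappa> by simp
    ultimately show ?thesis using eventually_ge_at_top[of 1]
      by eventually_elim auto
  qed
  have basic: "real (m n) < 2 * x n \<and> x n \<le> real (m n) \<and> 1 \<le> m n \<and> real (m n) \<le> \<kappa> * real n \<and>
      m n < n \<and> i0 \<le> m n \<and> b n \<le> 1"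
    if "n \<ge> 1 \<and> real i0 \<le> x n / 4 \<and> x n \<ge> 4 \<and> b n < \<kappa> / 2" for n
  proof -
    have 1: "x n \<le> real (m n)" "real (m n) < x n + 1"
      using that unfolding m_def by linarith+
    have "x n = b n * real n" using bx(1)[of n] that by (simp add: field_simps)
    also have "\<dots> \<le> \<kappa> / 2 * real n" using that by (intro mult_right_mono) auto
    finally have 2: "2 * x n \<le> \<kappa> * real n" by simp
    have "\<kappa> * real n \<le> real n" using \<kappa> by (simp add: mult_left_le_one_le)
    then have "real (m n) < real n" using 1 2 that by linarith
    then show ?thesis using 1 2 that \<kappa> by auto
  qed
  show "asymp_order (\<lambda>n. minimax_risk n \<sigma> (sobolev_ball n (G n) r \<beta> Q))
      (\<lambda>n. ennreal (real n powr (- 2 * \<beta> / (2 * \<beta> + r))))"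
    unfolding b_def[symmetric]
  proof (rule asymp_orderI)
    \<comment> \<open>\<open>D\<close> bounds the weights at the cutoff in terms of
      \<open>x n\<close>; the power of 2 pays for \<open>m n < 2 * x n\<close>. In \<open>a\<close>,
      the first term of the minimum is for the two-point bound and the second makes the cube fit
      into the ball.\<close>
    define D where "D = C2 powr \<beta> * 2 powr (2 * \<beta> / r)"
    have D: "D \<ge> 0" by (simp add: D_def)
    define a where "a = min (\<sigma> / 2) (Q / sqrt (2 * (1 + D)))"
    have a0: "0 < a" using assms(4) Q D by (simp add: a_def)
    have a_le: "a \<le> \<sigma> / 2" "a \<le> Q / sqrt (2 * (1 + D))"
      unfolding a_def by (rule min.cobounded1 min.cobounded2)+
    note a = a0 a_le
    have aQ: "2 * (1 + D) * a\<^sup>2 \<le> Q\<^sup>2"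
    proof -
      have "a\<^sup>2 \<le> (Q / sqrt (2 * (1 + D)))\<^sup>2" using a(1,3) by (intro power_mono) auto
      also have "\<dots> = Q\<^sup>2 / (2 * (1 + D))" using D by (simp add: power_divide)
      finally show ?thesis using D by (subst (asm) pos_le_divide_eq) (simp_all add: mult.commute)
    qed
    \<comment> \<open>The constant combines \<open>card J \<ge> x n / 2\<close> with the factor 1/4
      of the cube bound.\<close>
    show "0 < a\<^sup>2 / 8" using a by simp
    show "\<forall>\<^sub>F n in sequentially. 0 < b n"
      using eventually_ge_at_top[of 1] by eventually_elim (simp add: b_def)
    show "\<forall>\<^sub>F n in sequentially. minimax_risk n \<sigma> (sobolev_ball n (G n) r \<beta> Q) \<le>
        ennreal ((2 * \<sigma>\<^sup>2 + Q\<^sup>2 / C1 powr \<beta>) * b n)"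
      using ev geo
    proof eventually_elim
      case (elim n)
      note bas = basic[OF elim(1)]
      have n: "n \<ge> 1" using elim(1) by simp
      have "minimax_risk n \<sigma> (sobolev_ball n (G n) r \<beta> Q) \<le>
          ennreal (\<sigma>\<^sup>2 * real (m n) / real n + Q\<^sup>2 / (C1 powr \<beta> * real (m n) powr (2 * \<beta> / r)))"
        using bas elim(2) C \<beta> sym[OF n] n by (intro minimax_risk_sobolev_upper) auto
      also have "\<dots> \<le> ennreal ((2 * \<sigma>\<^sup>2 + Q\<^sup>2 / C1 powr \<beta>) * b n)"
      proof (rule ennreal_leI)
        have "\<sigma>\<^sup>2 * real (m n) / real n \<le> \<sigma>\<^sup>2 * (2 * x n) / real n"
          using bas by (intro divide_right_mono mult_left_mono) auto
        also have "\<dots> = 2 * \<sigma>\<^sup>2 * b n" by (simp add: bx(1)[OF n, symmetric])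
        finally have 1: "\<sigma>\<^sup>2 * real (m n) / real n \<le> 2 * \<sigma>\<^sup>2 * b n" .
        have x0: "x n > 0" using elim(1) by simp
        have bX: "b n = 1 / x n powr (2 * \<beta> / r)"
          using bx(2)[OF n] x0 by (subst nonzero_eq_divide_eq) auto
        have "Q\<^sup>2 / (C1 powr \<beta> * real (m n) powr (2 * \<beta> / r)) \<le>
            Q\<^sup>2 / (C1 powr \<beta> * x n powr (2 * \<beta> / r))"
          using bas x0 C \<beta> assms(2)
          by (intro divide_left_mono mult_left_mono powr_mono2 mult_pos_pos) auto
        also have "\<dots> = Q\<^sup>2 / C1 powr \<beta> * b n"
          using bX by simp
        finally show "\<sigma>\<^sup>2 * real (m n) / real n + Q\<^sup>2 / (C1 powr \<beta> * real (m n) powr (2 * \<beta> / r)) \<le>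
            (2 * \<sigma>\<^sup>2 + Q\<^sup>2 / C1 powr \<beta>) * b n"
          using 1 by (simp add: distrib_right)
      qed
      finally show ?case .
    qed
    show "\<forall>\<^sub>F n in sequentially. ennreal (a\<^sup>2 / 8 * b n) \<le>
        minimax_risk n \<sigma> (sobolev_ball n (G n) r \<beta> Q)"
      using ev geo
    proof eventually_elim
      case (elim n)
      note bas = basic[OF elim(1)]
      have n: "n \<ge> 1" using elim(1) by simp
      have x0: "x n > 0" using elim(1) by simp
      \<comment> \<open>The eigenvalues below \<open>i0\<close>, about which nothing is assumed, are left out.\<close>
      define J where "J = {Suc i0..m n}"
      have geo_J: "C1 * (real j / real n) powr (2 / r) \<le> lap_eigenvalue n (G n) j"
        "lap_eigenvalue n (G n) j \<le> C2 * (real j / real n) powr (2 / r)" if "j \<in> J" for j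
        using that elim(2) bas by (auto simp: J_def)
      have pos_J: "0 \<le> lap_eigenvalue n (G n) j" if "j \<in> J" for j
        using order_trans[OF _ geo_J(1)[OF that]] C by simp
      have xn: "x n = b n * real n" using bx(1)[OF n] n by (simp add: field_simps)
      have mx: "real (m n) powr (2 * \<beta> / r) \<le> 2 powr (2 * \<beta> / r) * x n powr (2 * \<beta> / r)"
        using bas x0 \<beta> assms(2) by (subst powr_mult[symmetric]) (auto intro!: powr_mono2)
      have CD: "C2 powr \<beta> * real (m n) powr (2 * \<beta> / r) \<le> D * x n powr (2 * \<beta> / r)"
        unfolding D_def mult.assoc using mx by (intro mult_left_mono) auto
      \<comment> \<open>Writing one factor \<open>x n\<close> as \<open>b n * n\<close> lets
        \<open>b n\<close> cancel the growth of the weights, leaving n times a constant.\<close>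
      have "real (m n) * a\<^sup>2 * (1 + C2 powr \<beta> * real (m n) powr (2 * \<beta> / r)) \<le>
          (2 * x n) * a\<^sup>2 * (1 + D * x n powr (2 * \<beta> / r))"
        using bas x0 C by (intro mult_mono[OF mult_right_mono add_left_mono[OF CD]]) auto
      also have "\<dots> = 2 * a\<^sup>2 * real n * (b n + D * (b n * x n powr (2 * \<beta> / r)))"
        by (subst xn) (simp add: algebra_simps)
      also have "\<dots> = 2 * a\<^sup>2 * real n * (b n + D)" by (simp add: bx(2)[OF n])
      also have "\<dots> \<le> 2 * a\<^sup>2 * real n * (1 + D)" using bas by (intro mult_left_mono) auto
      also have "\<dots> \<le> Q\<^sup>2 * real n"
        using mult_right_mono[OF aQ, of "real n"] by (simp add: algebra_simps)
      finally have fit: "real (m n) * a\<^sup>2 * (1 + C2 powr \<beta> * real (m n) powr (2 * \<beta> / r)) \<le> Q\<^sup>2 * real n" .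
      \<comment> \<open>\<open>card J\<close> is \<open>m n - i0\<close>. Starting at
        \<open>Suc i0\<close> also keeps index 0 out of \<open>J\<close> when \<open>i0\<close> is
        0.\<close>
      have "x n / 2 \<le> real (card J)"
        using elim(1) bas by (simp add: J_def of_nat_diff)
      then have "x n / 2 * a\<^sup>2 / (4 * real n) \<le> real (card J) * a\<^sup>2 / (4 * real n)"
        by (intro divide_right_mono mult_right_mono) auto
      then have "a\<^sup>2 / 8 * b n \<le> real (card J) * a\<^sup>2 / (4 * real n)"
        by (simp add: bx(1)[OF n, symmetric] mult_ac)
      then have "ennreal (a\<^sup>2 / 8 * b n) \<le> ennreal (real (card J) * a\<^sup>2 / (4 * real n))"
        by (rule ennreal_leI)
      also have "\<dots> \<le> minimax_risk n \<sigma> (sobolev_ball n (G n) r \<beta> Q)"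
        using bas C \<beta> assms(2,4) sym[OF n] n a pos_J geo_J(2) fit
        by (intro minimax_risk_sobolev_lower[where m = "m n" and C = C2]) (auto simp: J_def)
      finally show ?case .
    qed
  qed
qed

end
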